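(* The set \[ \mathcal D:=\Big\{f\in L^1(\mathbb T): \mu_{\mathbb T}\big(\{x\in\mathbb T: \sup_{N\in\mathbb N}|D_N*f(x)|=\infty\}\big)=1\Big\} \] is of the second Baire category in $L^1(\mathbb T)$. In particular, the set of all $f\in L^1(\mathbb T)$ whose Fourier series diverges almost everywhere on $\mathbb T$ (i.e. for which the sequence of partial sums $(D_N*f(x))_{N\in\mathbb N}$ fails to converge for $\mu_{\mathbb T}$-almost every $x\in\mathbb T$) is of the second Baire category in $L^1(\mathbb T)$.
   Context: $\mathbb T:=\mathbb R/\mathbb Z$ is the torus, endowed with the Lebesgue measure $\mu_{\mathbb T}$ inherited from $\mathbb R$ (so $\mu_{\mathbb T}(\mathbb T)=1$). $L^1(\mathbb T)$ is the complex Banach space of (classes of) integrable functions $f:\mathbb T\to\mathbb C$ with its usual norm $\|f\|_{L^1(\mathbb T)}=\int_{\mathbb T}|f(x)|\,dx$. $\mathbb N=\{0,1,2,\ldots\}$. Write $e(x):=e^{2\pi i x}$. The Dirichlet kernel is $D_N(x):=\sum_{n\in[-N,N]\cap\mathbb Z}e(xn)$. For $f\in L^1(\mathbb T)$, with Fourier coefficients $\widehat f(n):=\int_{\mathbb T}f(x)e(-xn)\,dx$, $n\in\mathbb Z$, the partial sums of the Fourier series of $f$ are \[ D_N*f(x)=\int_{\mathbb T}f(x-y)D_N(y)\,dy=\sum_{n\in[-N,N]\cap\mathbb Z}\widehat f(n)e(xn),\qquad x\in\mathbb T,\ N\in\mathbb N. \] A subset of a topological space is of the first Baire category if it is a countable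 union of nowhere dense sets, and of the second Baire category if it is not of the first Baire category. *)

theory Defs
  imports "HOL-Analysis.Analysis"
begin

section \<open>The torus\<close>

quotient_type torus = real / "\<lambda>x y :: real. x - y \<in> \<int>"
proof (rule equivpI)
  show "reflp (\<lambda>x y :: real. x - y \<in> \<int>)"
    by (auto intro: reflpI)
  show "symp (\<lambda>x y :: real. x - y \<in> \<int>)"
    by (rule sympI) (metis Ints_minus minus_diff_eq)
  show "transp (\<lambda>x y :: real. x - y \<in> \<int>)"
    by (rule transpI) (metis Ints_add diff_add_cancel add_diff_eq)
qed

instantiation torus :: ab_group_add
begin

lift_definition zero_torus :: torus is "0 :: real" .

lift_definition plus_torus :: "torus \<Rightarrow> torus \<Rightarrow> torus" is "\<lambda>x y. x + y"
  by (metis Ints_add add_diff_add)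

lift_definition uminus_torus :: "torus \<Rightarrow> torus" is "\<lambda>x. - x"
  by (metis Ints_minus minus_diff_minus)

lift_definition minus_torus :: "torus \<Rightarrow> torus \<Rightarrow> torus" is "\<lambda>x y. x - y"
proof -
  fix a b c d :: real
  assume "a - b \<in> \<int>" "c - d \<in> \<int>"
  then have "(a - b) - (c - d) \<in> \<int>" by (rule Ints_diff)
  then show "a - c - (b - d) \<in> \<int>" by (simp add: algebra_simps)
qed

instance
  by standard (transfer; simp)+

end

text \<open>The Lebesgue measure of the torus: a set is measurable iff its preimage in the real line
  is, and its measure is that of the trace of this preimage on a fundamental domain.\<close>

definition torus_measure :: "torus measure" where
  "torus_measure =
     distr (lebesgue_on {0..<1}) (sigma UNIV {A. abs_torus -` A \<in> sets lebesgue}) abs_torus"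

lemma sets_torus_measure: "sets torus_measure = {A. abs_torus -` A \<in> sets lebesgue}"
proof -
  have "sigma_algebra UNIV {A. abs_torus -` A \<in> sets lebesgue}"
  proof (rule sigma_algebra_iff2[THEN iffD2], intro conjI ballI allI impI)
    fix A assume "A \<in> {A. abs_torus -` A \<in> sets lebesgue}"
    then have "UNIV - abs_torus -` A \<in> sets lebesgue"
      using sets.compl_sets[of _ lebesgue] by auto
    then show "UNIV - A \<in> {A. abs_torus -` A \<in> sets lebesgue}"
      by (simp add: vimage_Diff)
  next
    fix A :: "nat \<Rightarrow> torus set"
    assume "range A \<subseteq> {A. abs_torus -` A \<in> sets lebesgue}"
    then have "(\<Union>i. abs_torus -` A i) \<in> sets lebesgue" by auto
    then show "(\<Union>i. A i) \<in> {A. abs_torus -` A \<in> sets lebesgue}"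
      by (simp add: vimage_UN)
  qed auto
  then show ?thesis
    unfolding torus_measure_def
    by (simp add: sigma_algebra.sigma_sets_eq)
qed

lemma space_torus_measure [simp]: "space torus_measure = UNIV"
  by (simp add: torus_measure_def)

lemma measurable_abs_torus: "abs_torus \<in> lebesgue \<rightarrow>\<^sub>M torus_measure"
  by (rule measurableI) (auto simp: sets_torus_measure)

lemma torus_measure_eq: "torus_measure = distr (lebesgue_on {0..<1}) torus_measure abs_torus"
proof -
  have "sets (sigma UNIV {A. abs_torus -` A \<in> sets lebesgue}) = sets torus_measure"
    unfolding torus_measure_def by (rule sets_distr[symmetric])
  then have "distr (lebesgue_on {0..<1}) (sigma UNIV {A. abs_torus -` A \<in> sets lebesgue}) abs_torus
      = distr (lebesgue_on {0..<1}) torus_measure abs_torus"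
    by (intro distr_cong refl)
  then show ?thesis
    by (simp only: torus_measure_def[symmetric])
qed

lemma emeasure_torus_measure:
  assumes "A \<in> sets torus_measure"
  shows "emeasure torus_measure A = emeasure lebesgue (abs_torus -` A \<inter> {0..<1})"
proof -
  have "emeasure torus_measure A
      = emeasure (lebesgue_on {0..<1}) (abs_torus -` A \<inter> {0..<1})"
    using emeasure_distr[OF measurable_restrict_space1[OF measurable_abs_torus] assms,
        of "{0..<1}"]
    by (simp flip: torus_measure_eq)
  also have "\<dots> = emeasure lebesgue (abs_torus -` A \<inter> {0..<1})"
    by (rule emeasure_restrict_space) auto
  finally show ?thesis .
qed

lemma emeasure_torus_measure_UNIV: "emeasure torus_measure UNIV = 1"
  using emeasure_torus_measure[of UNIV] by (simp add: sets_torus_measure)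

lemma finite_torus_measure: "finite_measure torus_measure"
  by (rule finite_measureI) (simp add: emeasure_torus_measure_UNIV)

lemma abs_torus_eq_iff: "abs_torus x = abs_torus y \<longleftrightarrow> x - y \<in> \<int>"
  by (rule torus.abs_eq_iff)

lemma lebesgue_image_reflect:
  fixes S :: "real set"
  assumes "S \<in> sets lebesgue"
  shows "(\<lambda>y. a - y) ` S \<in> sets lebesgue"
    and "emeasure lebesgue ((\<lambda>y. a - y) ` S) = emeasure lebesgue S"
proof -
  have "(\<lambda>y. a - y) = (\<lambda>y. a + (-1) * y)" by auto
  then show "emeasure lebesgue ((\<lambda>y. a - y) ` S) = emeasure lebesgue S"
    using emeasure_lebesgue_affine[of "-1" a S] by simp
  have "(\<lambda>y. a - y) ` S = (\<lambda>y. a - y) -` S \<inter> space lebesgue"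
    by (force simp: image_iff)
  moreover have "(\<lambda>y. a - y) \<in> lebesgue \<rightarrow>\<^sub>M lebesgue"
    using lebesgue_affine_measurable[where c = "\<lambda>_. -1 :: real" and t = a] by simp
  ultimately show "(\<lambda>y. a - y) ` S \<in> sets lebesgue"
    using assms measurable_sets by metis
qed

lemma lebesgue_image_shift:
  fixes S :: "real set"
  assumes "S \<in> sets lebesgue"
  shows "(\<lambda>y. a + y) ` S \<in> sets lebesgue"
    and "emeasure lebesgue ((\<lambda>y. a + y) ` S) = emeasure lebesgue S"
proof -
  show "(\<lambda>y. a + y) ` S \<in> sets lebesgue"
    using lebesgue_sets_translation[OF assms, of a] by simp
  have "(\<lambda>y. a + y) = (\<lambda>y. 1 *\<^sub>R y + a)" by auto
  then show "emeasure lebesgue ((\<lambda>y. a + y) ` S) = emeasure lebesgue S"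
    using emeasure_lebesgue_affine[of 1 a S] by simp
qed

text \<open>The measure of the torus is invariant under the reflections \<open>y \<mapsto> x - y\<close>, so that
  convolution is compatible with equality almost everywhere.\<close>

lemma distr_torus_measure_reflect:
  "distr torus_measure torus_measure (\<lambda>y. x - y) = torus_measure" (is "?D = _")
  and measurable_torus_reflect: "(\<lambda>y. x - y) \<in> torus_measure \<rightarrow>\<^sub>M torus_measure"
proof -
  define a where "a = frac (rep_torus x)"
  have x: "x = abs_torus a"
    by (metis (no_types, lifting) a_def frac_def Ints_of_int Quotient_torus Quotient_abs_rep
        abs_torus_eq_iff add_diff_cancel_left' diff_diff_eq2 diff_add_cancel
        Ints_minus minus_diff_eq)
  have a: "0 \<le> a" "a < 1"
    by (auto simp: a_def frac_lt_1)
  have vim: "abs_torus -` ((\<lambda>y. x - y) -` A) = (\<lambda>y. a - y) ` (abs_torus -` A)" for A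
    by (force simp: x minus_torus.abs_eq image_iff)
  show meas: "(\<lambda>y. x - y) \<in> torus_measure \<rightarrow>\<^sub>M torus_measure"
    by (rule measurableI) (auto simp: sets_torus_measure vim intro: lebesgue_image_reflect)
  show "?D = torus_measure"
  proof (rule measure_eqI)
    fix A assume "A \<in> sets ?D"
    then have A: "A \<in> sets torus_measure" by simp
    define P where "P = abs_torus -` A"
    have P: "P \<in> sets lebesgue" using A by (simp add: P_def sets_torus_measure)
    have per: "y + 1 \<in> P \<longleftrightarrow> y \<in> P" for y
    proof -
      have "abs_torus (y + 1) = abs_torus y" by (simp add: abs_torus_eq_iff)
      then show ?thesis by (simp add: P_def)
    qed
    have shift: "(\<lambda>y. 1 + y) ` (P \<inter> S) = P \<inter> (\<lambda>y. 1 + y) ` S" for S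
      using per by (auto simp: image_iff add.commute)
    have "emeasure ?D A = emeasure torus_measure ((\<lambda>y. x - y) -` A)"
      using meas A by (simp add: emeasure_distr)
    also have "\<dots> = emeasure lebesgue ((\<lambda>y. a - y) ` P \<inter> {0..<1})"
      using measurable_sets[OF meas A] by (simp add: emeasure_torus_measure vim P_def)
    also have "(\<lambda>y. a - y) ` P \<inter> {0..<1} = (\<lambda>y. a - y) ` (P \<inter> {a - 1<..a})"
      by (auto simp: image_iff)
    also have "emeasure lebesgue \<dots> = emeasure lebesgue (P \<inter> {a - 1<..a})"
      using P by (intro lebesgue_image_reflect) auto
    also have "P \<inter> {a - 1<..a} = (P \<inter> {a - 1<..<0}) \<union> (P \<inter> {0..a})"
      using a by auto
    also have "emeasure lebesgue \<dots>
        = emeasure lebesgue (P \<inter> {a - 1<..<0}) + emeasure lebesgue (P \<inter> {0..a})"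
      using P by (intro plus_emeasure[symmetric]) auto
    also have "emeasure lebesgue (P \<inter> {a - 1<..<0}) = emeasure lebesgue (P \<inter> {a<..<1})"
    proof -
      have "(\<lambda>y. 1 + y) ` {a - 1<..<0} = {a<..<1}"
      proof (intro set_eqI iffI)
        fix z assume "z \<in> {a<..<1}"
        then show "z \<in> (\<lambda>y. 1 + y) ` {a - 1<..<0}"
          by (intro image_eqI[of _ _ "z - 1"]) auto
      qed auto
      then have "(\<lambda>y. 1 + y) ` (P \<inter> {a - 1<..<0}) = P \<inter> {a<..<1}"
        by (simp only: shift)
      moreover have "P \<inter> {a - 1<..<0} \<in> sets lebesgue"
        using P by auto
      ultimately show ?thesis
        using lebesgue_image_shift(2)[of "P \<inter> {a - 1<..<0}" 1] by metis
    qed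
    also have "\<dots> + emeasure lebesgue (P \<inter> {0..a})
        = emeasure lebesgue ((P \<inter> {a<..<1}) \<union> (P \<inter> {0..a}))"
      using P by (intro plus_emeasure) auto
    also have "(P \<inter> {a<..<1}) \<union> (P \<inter> {0..a}) = P \<inter> {0..<1}"
      using a by auto
    also have "emeasure lebesgue \<dots> = emeasure torus_measure A"
      using A by (simp add: emeasure_torus_measure P_def)
    finally show "emeasure ?D A = emeasure torus_measure A" .
  qed simp
qed

lemma AE_torus_reflect:
  assumes "AE y in torus_measure. P y"
  shows "AE y in torus_measure. P (x - y)"
proof -
  from assms obtain N where N: "{y. \<not> P y} \<subseteq> N" "N \<in> null_sets torus_measure"
    by (auto elim!: AE_E simp: null_sets_def)
  have "emeasure torus_measure ((\<lambda>y. x - y) -` N)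
      = emeasure (distr torus_measure torus_measure (\<lambda>y. x - y)) N"
    using N(2) by (subst emeasure_distr[OF measurable_torus_reflect]) auto
  also have "\<dots> = 0"
    using N(2) by (simp add: distr_torus_measure_reflect null_sets_def)
  finally have "(\<lambda>y. x - y) -` N \<in> null_sets torus_measure"
    using N(2) measurable_sets[OF measurable_torus_reflect, of N x] by (auto simp: null_sets_def)
  then show ?thesis
    by (rule AE_I') (use N(1) in auto)
qed


section \<open>The space of classes of integrable functions on the torus\<close>

quotient_type torus_L1 = "torus \<Rightarrow> complex" / partial:
  "\<lambda>f g. integrable torus_measure f \<and> integrable torus_measure g \<and>
         (AE x in torus_measure. f x = g x)"
proof (rule part_equivpI)
  show "\<exists>f :: torus \<Rightarrow> complex. integrable torus_measure f \<and> integrable torus_measure f \<and>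
      (AE x in torus_measure. f x = f x)"
    by (rule exI[of _ "\<lambda>_. 0"]) simp
  show "symp (\<lambda>f g :: torus \<Rightarrow> complex. integrable torus_measure f \<and>
      integrable torus_measure g \<and> (AE x in torus_measure. f x = g x))"
    by (rule sympI) (auto simp: eq_commute)
  show "transp (\<lambda>f g :: torus \<Rightarrow> complex. integrable torus_measure f \<and>
      integrable torus_measure g \<and> (AE x in torus_measure. f x = g x))"
    by (rule transpI) (auto elim: eventually_elim2)
qed

text \<open>Only the structure of a real normed space is needed to speak of the norm topology (and the
  library has no class of complex normed spaces).\<close>

instantiation torus_L1 :: real_normed_vector
begin

lift_definition zero_torus_L1 :: torus_L1 is "\<lambda>_. 0"
  by simp

lift_definition plus_torus_L1 :: "torus_L1 \<Rightarrow> torus_L1 \<Rightarrow> torus_L1" is "\<lambda>f g x. f x + g x"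
  by (auto elim: eventually_elim2)

lift_definition uminus_torus_L1 :: "torus_L1 \<Rightarrow> torus_L1" is "\<lambda>f x. - f x"
  by (auto elim: eventually_mono)

lift_definition minus_torus_L1 :: "torus_L1 \<Rightarrow> torus_L1 \<Rightarrow> torus_L1" is "\<lambda>f g x. f x - g x"
  by (auto elim: eventually_elim2)

lift_definition scaleR_torus_L1 :: "real \<Rightarrow> torus_L1 \<Rightarrow> torus_L1" is "\<lambda>c f x. c *\<^sub>R f x"
  by (auto elim: eventually_mono)

lift_definition norm_torus_L1 :: "torus_L1 \<Rightarrow> real" is "\<lambda>f. \<integral>x. cmod (f x) \<partial>torus_measure"
  by (rule integral_cong_AE) (auto elim: eventually_mono)

definition sgn_torus_L1 :: "torus_L1 \<Rightarrow> torus_L1" where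
  "sgn_torus_L1 f = inverse (norm f) *\<^sub>R f"

definition dist_torus_L1 :: "torus_L1 \<Rightarrow> torus_L1 \<Rightarrow> real" where
  "dist_torus_L1 f g = norm (f - g)"

definition uniformity_torus_L1 :: "(torus_L1 \<times> torus_L1) filter" where
  "uniformity_torus_L1 = (INF e\<in>{0<..}. principal {(f, g). dist f g < e})"

definition open_torus_L1 :: "torus_L1 set \<Rightarrow> bool" where
  "open_torus_L1 U = (\<forall>f\<in>U. eventually (\<lambda>(f', g). f' = f \<longrightarrow> g \<in> U) uniformity)"

instance
proof
  fix f g h :: torus_L1 and a b :: real
  show "f + g + h = f + (g + h)" by transfer (auto simp: algebra_simps)
  show "f + g = g + f" by transfer (auto simp: algebra_simps)
  show "0 + f = f" by transfer auto
  show "- f + f = 0" by transfer auto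
  show "f - g = f + - g" by transfer auto
  show "a *\<^sub>R (f + g) = a *\<^sub>R f + a *\<^sub>R g" by transfer (auto simp: algebra_simps)
  show "(a + b) *\<^sub>R f = a *\<^sub>R f + b *\<^sub>R f" by transfer (auto simp: algebra_simps)
  show "a *\<^sub>R b *\<^sub>R f = (a * b) *\<^sub>R f" by transfer (auto simp: algebra_simps)
  show "1 *\<^sub>R f = f" by transfer auto
  show "dist f g = norm (f - g)" by (rule dist_torus_L1_def)
  show "sgn f = inverse (norm f) *\<^sub>R f" by (rule sgn_torus_L1_def)
  show "uniformity = (INF e\<in>{0<..}. principal {(f, g :: torus_L1). dist f g < e})"
    by (rule uniformity_torus_L1_def)
  show "open U = (\<forall>f\<in>U. eventually (\<lambda>(f', g). f' = f \<longrightarrow> g \<in> U) uniformity)"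
    for U :: "torus_L1 set" by (rule open_torus_L1_def)
  show "norm f = 0 \<longleftrightarrow> f = 0"
    by transfer (subst integral_nonneg_eq_0_iff_AE, auto)
  show "norm (f + g) \<le> norm f + norm g"
  proof transfer
    fix f g :: "torus \<Rightarrow> complex"
    assume *: "integrable torus_measure f \<and> integrable torus_measure f \<and>
        (AE x in torus_measure. f x = f x)"
      "integrable torus_measure g \<and> integrable torus_measure g \<and>
        (AE x in torus_measure. g x = g x)"
    then have "(\<integral>x. cmod (f x + g x) \<partial>torus_measure)
        \<le> (\<integral>x. cmod (f x) + cmod (g x) \<partial>torus_measure)"
      by (intro integral_mono) (auto intro: norm_triangle_ineq)
    also have "\<dots> = (\<integral>x. cmod (f x) \<partial>torus_measure) + (\<integral>x. cmod (g x) \<partial>torus_measure)"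
      using * by simp
    finally show "(\<integral>x. cmod (f x + g x) \<partial>torus_measure)
        \<le> (\<integral>x. cmod (f x) \<partial>torus_measure) + (\<integral>x. cmod (g x) \<partial>torus_measure)" .
  qed
  show "norm (a *\<^sub>R f) = \<bar>a\<bar> * norm f" by transfer simp
qed

end


section \<open>Fourier series\<close>

text \<open>\<open>e_torus n x\<close> is \<open>e(xn)\<close>, where \<open>e(t) = exp (2 \<pi> i t)\<close>.\<close>

lift_definition e_torus :: "int \<Rightarrow> torus \<Rightarrow> complex" is
  "\<lambda>n x. exp (2 * of_real pi * \<i> * of_real (x * of_int n))"
proof -
  fix n :: int and x y :: real
  assume "x - y \<in> \<int>"
  then obtain k where "x - y = of_int k" by (auto elim: Ints_cases)
  then have "x = y + of_int k" by simp
  then have "2 * of_real pi * \<i> * of_real (x * of_int n)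
      = 2 * of_real pi * \<i> * of_real (y * of_int n) + (of_int (2 * (k * n)) * pi) * \<i>"
    by (simp add: algebra_simps)
  then show "exp (2 * of_real pi * \<i> * of_real (x * of_int n))
      = exp (2 * of_real pi * \<i> * of_real (y * of_int n))"
    using exp_eq by blast
qed

definition dirichlet_kernel :: "nat \<Rightarrow> torus \<Rightarrow> complex" where
  "dirichlet_kernel N x = (\<Sum>n\<in>{- int N..int N}. e_torus n x)"

lemma norm_e_torus [simp]: "cmod (e_torus n x) = 1"
  by transfer (simp add: norm_exp_eq_Re)

lemma e_torus_diff: "e_torus n (x - y) = e_torus n x * e_torus (- n) y"
  by transfer (simp add: algebra_simps flip: exp_add)

lemma borel_measurable_torusI:
  assumes "(\<lambda>x. f (abs_torus x)) \<in> borel_measurable lebesgue"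
  shows "f \<in> borel_measurable torus_measure"
proof (rule measurableI)
  fix A :: "'a set" assume "A \<in> sets borel"
  with assms have "(\<lambda>x. f (abs_torus x)) -` A \<inter> space lebesgue \<in> sets lebesgue"
    by (rule measurable_sets)
  then show "f -` A \<inter> space torus_measure \<in> sets torus_measure"
    by (simp add: sets_torus_measure vimage_def)
qed simp

lemma borel_measurable_e_torus [measurable]: "e_torus n \<in> borel_measurable torus_measure"
proof (rule borel_measurable_torusI)
  have "(\<lambda>x :: real. exp (2 * of_real pi * \<i> * of_real (x * of_int n))) \<in> borel_measurable borel"
    by (intro borel_measurable_continuous_onI continuous_intros)
  then have "(\<lambda>x :: real. exp (2 * of_real pi * \<i> * of_real (x * of_int n)))
      \<in> borel_measurable lebesgue"
    by (intro measurable_completion) simp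
  then show "(\<lambda>x. e_torus n (abs_torus x)) \<in> borel_measurable lebesgue"
    by (simp add: e_torus.abs_eq)
qed

lemma borel_measurable_dirichlet_kernel [measurable]:
  "dirichlet_kernel N \<in> borel_measurable torus_measure"
proof -
  have "(\<lambda>x. \<Sum>n\<in>{- int N..int N}. e_torus n x) \<in> borel_measurable torus_measure"
    by measurable
  then show ?thesis
    by (simp add: dirichlet_kernel_def[abs_def])
qed

lift_definition fourier_coeff :: "torus_L1 \<Rightarrow> int \<Rightarrow> complex" is
  "\<lambda>f n. \<integral>x. f x * e_torus (- n) x \<partial>torus_measure"
proof (intro ext)
  fix f g :: "torus \<Rightarrow> complex" and n :: int
  assume *: "integrable torus_measure f \<and> integrable torus_measure g \<and>
    (AE x in torus_measure. f x = g x)"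
  then have [measurable]: "f \<in> borel_measurable torus_measure" "g \<in> borel_measurable torus_measure"
    by auto
  from * have "AE x in torus_measure. f x * e_torus (- n) x = g x * e_torus (- n) x"
    by (auto elim: eventually_mono)
  moreover have "(\<lambda>x. f x * e_torus (- n) x) \<in> borel_measurable torus_measure"
    "(\<lambda>x. g x * e_torus (- n) x) \<in> borel_measurable torus_measure"
    by measurable
  ultimately show "(\<integral>x. f x * e_torus (- n) x \<partial>torus_measure)
      = (\<integral>x. g x * e_torus (- n) x \<partial>torus_measure)"
    by (intro Bochner_Integration.integral_cong_AE)
qed

text \<open>The partial sum \<open>D\<^sub>N * f\<close>. The convolution does not depend on the representative of \<open>f\<close>, so
  that its value at every single point \<open>x\<close> makes sense.\<close>

lift_definition fourier_partial_sum :: "nat \<Rightarrow> torus_L1 \<Rightarrow> torus \<Rightarrow> complex" is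
  "\<lambda>N f x. \<integral>y. f (x - y) * dirichlet_kernel N y \<partial>torus_measure"
proof (intro ext)
  fix f g :: "torus \<Rightarrow> complex" and N :: nat and x :: torus
  assume *: "integrable torus_measure f \<and> integrable torus_measure g \<and>
    (AE x in torus_measure. f x = g x)"
  then have [measurable]: "f \<in> borel_measurable torus_measure" "g \<in> borel_measurable torus_measure"
    by auto
  note [measurable] = measurable_torus_reflect[of x]
  from * have "AE y in torus_measure. f (x - y) = g (x - y)"
    by (intro AE_torus_reflect) simp
  then have "AE y in torus_measure.
      f (x - y) * dirichlet_kernel N y = g (x - y) * dirichlet_kernel N y"
    by eventually_elim simp
  moreover have "(\<lambda>y. f (x - y) * dirichlet_kernel N y) \<in> borel_measurable torus_measure"
    "(\<lambda>y. g (x - y) * dirichlet_kernel N y) \<in> borel_measurable torus_measure"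
    by measurable
  ultimately show "(\<integral>y. f (x - y) * dirichlet_kernel N y \<partial>torus_measure)
      = (\<integral>y. g (x - y) * dirichlet_kernel N y \<partial>torus_measure)"
    by (intro Bochner_Integration.integral_cong_AE)
qed

lemma fourier_partial_sum_eq:
  "fourier_partial_sum N f x = (\<Sum>n\<in>{- int N..int N}. fourier_coeff f n * e_torus n x)"
proof (transfer fixing: x)
  fix N :: nat and f :: "torus \<Rightarrow> complex" and x :: torus
  assume "integrable torus_measure f \<and> integrable torus_measure f \<and>
    (AE x in torus_measure. f x = f x)"
  then have f: "integrable torus_measure f" by simp
  then have [measurable]: "f \<in> borel_measurable torus_measure" by auto
  note [measurable] = measurable_torus_reflect[of x]
  have int: "integrable torus_measure (\<lambda>y. f (x - y) * e_torus n y)" for n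
  proof -
    have "integrable torus_measure (\<lambda>y. f (x - y))"
      using f by (intro integrable_distr[OF measurable_torus_reflect])
        (simp add: distr_torus_measure_reflect)
    then show ?thesis
      by (rule Bochner_Integration.integrable_bound) (auto simp: norm_mult)
  qed
  have eq: "(\<integral>y. f (x - y) * e_torus n y \<partial>torus_measure)
      = (\<integral>y. f y * e_torus (- n) y \<partial>torus_measure) * e_torus n x" for n
  proof -
    have "(\<integral>y. f y * e_torus n (x - y) \<partial>torus_measure)
        = (\<integral>y. f y * e_torus n (x - y) \<partial>distr torus_measure torus_measure (\<lambda>y. x - y))"
      by (simp add: distr_torus_measure_reflect)
    also have "\<dots> = (\<integral>y. f (x - y) * e_torus n (x - (x - y)) \<partial>torus_measure)"
      by (rule integral_distr) measurable
    finally have "(\<integral>y. f (x - y) * e_torus n y \<partial>torus_measure)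
        = (\<integral>y. f y * e_torus n (x - y) \<partial>torus_measure)"
      by simp
    also have "\<dots> = (\<integral>y. f y * e_torus (- n) y * e_torus n x \<partial>torus_measure)"
      by (simp add: e_torus_diff mult_ac)
    also have "\<dots> = (\<integral>y. f y * e_torus (- n) y \<partial>torus_measure) * e_torus n x"
      by (rule integral_mult_left_zero)
    finally show ?thesis .
  qed
  have "(\<integral>y. f (x - y) * dirichlet_kernel N y \<partial>torus_measure)
      = (\<Sum>n\<in>{- int N..int N}. \<integral>y. f (x - y) * e_torus n y \<partial>torus_measure)"
    unfolding dirichlet_kernel_def sum_distrib_left
    by (rule Bochner_Integration.integral_sum) (rule int)
  then show "(\<integral>y. f (x - y) * dirichlet_kernel N y \<partial>torus_measure)
      = (\<Sum>n\<in>{- int N..int N}.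
           (\<integral>y. f y * e_torus (- n) y \<partial>torus_measure) * e_torus n x)"
    by (simp add: eq)
qed


section \<open>Baire category\<close>

definition nowhere_dense :: "'a::topological_space set \<Rightarrow> bool" where
  "nowhere_dense S \<longleftrightarrow> interior (closure S) = {}"

definition first_category :: "'a::topological_space set \<Rightarrow> bool" where
  "first_category S \<longleftrightarrow> (\<exists>\<A>. countable \<A> \<and> (\<forall>A\<in>\<A>. nowhere_dense A) \<and> S = \<Union>\<A>)"

definition second_category :: "'a::topological_space set \<Rightarrow> bool" where
  "second_category S \<longleftrightarrow> \<not> first_category S"

end

theory Submission
  imports Defs
begin

text \<open>
  The set \<open>\<D>\<close> of functions with almost everywhere unbounded partial sums is shown to be residual: its
  complement is covered by countably many closed sets with empty interior, so that by the theorem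
  of Baire, in the complete space \<open>L\<^sup>1\<close>, the set \<open>\<D>\<close> is not of the first category.

  If \<open>f \<notin> \<D>\<close>, then the sets where \<open>sup\<^sub>N \<bar>D\<^sub>N * f\<bar> \<le> m\<close> for some natural number \<open>m\<close> are not all null,
  so \<open>f\<close> belongs to some set \<open>F(M, \<epsilon>)\<close>, \<open>often_bounded\<close> below, of the functions for which
  \<open>sup\<^sub>N \<bar>D\<^sub>N * f\<bar> \<le> M\<close> holds on a set of measure at least \<open>\<epsilon> > 0\<close>. Each such set is closed because
  \<open>f \<mapsto> D\<^sub>N * f\<close> is continuous from \<open>L\<^sup>1\<close> to the uniform norm. Suppose that it contains a ball around
  \<open>f\<close>. For every \<open>g\<close> of norm at most 1 it then contains \<open>f + j s g\<close> for \<open>j < k\<close>, where \<open>k > 2 / \<epsilon>\<close> and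
  \<open>s\<close> is small. Of \<open>k\<close> sets of measure at least \<open>\<epsilon>\<close> in a space of measure 1, two overlap in measure at
  least \<open>1 / k\<^sup>2\<close>; on the overlap, taking the difference of two of these functions,
  \<open>sup\<^sub>N \<bar>D\<^sub>N * g\<bar> \<le> 2 M / s\<close>. Hence the set where the partial sums of \<open>g\<close> are bounded by a certain
  constant has a measure bounded below uniformly in \<open>g\<close>. (Comparing two perturbations of the unknown \<open>f\<close>
  takes the place of an approximation of \<open>f\<close> by trigonometric polynomials.)

  This contradicts the construction of Kolmogorov. Choose points \<open>x\<^sub>j\<close> in \<open>(j/n, (j+1)/n)\<close>, \<open>j < n\<close>, that
  together with 1 are linearly independent over the rationals. For all \<open>t\<close> outside a countable set,
  the differences \<open>t - x\<^sub>j\<close> and 1 are independent too, and the theorem of Kronecker gives an \<open>N\<close> for which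
  all \<open>sin ((2N+1) \<pi> (t - x\<^sub>j))\<close> have, up to a common sign, the sign of \<open>sin (\<pi> (t - x\<^sub>j))\<close> and absolute
  value at least 1/2. For this \<open>N\<close> no cancellation occurs in the average of the numbers
  \<open>D\<^sub>N (t - x\<^sub>j)\<close>, whose absolute value is therefore at least a constant times
  \<open>1/n (\<Sum>j<n. 1 / \<bar>sin (\<pi> (t - x\<^sub>j))\<bar>)\<close>, hence at least a constant times the harmonic number of \<open>n\<close>.
  So the average of \<open>n\<close> Dirac masses has
  \<open>sup\<^sub>N\<close> of its partial sums above any given constant almost everywhere. Finitely many \<open>N\<close> suffice up to
  small measure, and for these the Dirac masses can be replaced by normalised indicator functions of
  short intervals.
\<close>


section \<open>Linear independence modulo 1 and the theorem of Kronecker\<close>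

text \<open>Equivalently, the numbers \<open>x 0, \<dots>, x (n - 1), 1\<close> are distinct and linearly independent over the
  rationals. Membership in \<open>\<int>\<close> absorbs the coefficient of 1.\<close>

definition independent_mod_1 :: "nat \<Rightarrow> (nat \<Rightarrow> real) \<Rightarrow> bool" where
  "independent_mod_1 n x \<longleftrightarrow>
     (\<forall>a :: nat \<Rightarrow> int. (\<Sum>j<n. of_int (a j) * x j) \<in> \<int> \<longrightarrow> (\<forall>j<n. a j = 0))"

lemma independent_mod_1D:
  assumes "independent_mod_1 n x" "(\<Sum>j<n. of_int (a j) * x j) \<in> \<int>" "j < n"
  shows "a j = 0"
  using assms unfolding independent_mod_1_def by blast

text \<open>In a dependence relation the new point \<open>t\<close> must occur with a nonzero coefficient, so the relation
  determines \<open>t\<close>; and there are only countably many relations. The lemma serves twice: for choosing the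
  points one after the other, and for discarding the countably many \<open>t\<close> to which the
  theorem of Kronecker does not apply.\<close>

lemma countable_dependent_extensions:
  assumes "independent_mod_1 n x"
  shows "countable {t. \<not> independent_mod_1 (Suc n) (x(n := t))}"
proof -
  let ?h = "\<lambda>(k :: int, c :: int, as :: int list).
    (of_int k - (\<Sum>j<n. of_int (as ! j) * x j)) / of_int c"
  have "t \<in> range ?h" if t: "\<not> independent_mod_1 (Suc n) (x(n := t))" for t
  proof -
    obtain a :: "nat \<Rightarrow> int"
      where a: "(\<Sum>j<Suc n. of_int (a j) * (x(n := t)) j) \<in> \<int>" "\<not> (\<forall>j<Suc n. a j = 0)"
      using t unfolding independent_mod_1_def by blast
    obtain k where "(\<Sum>j<Suc n. of_int (a j) * (x(n := t)) j) = of_int k"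
      using a(1) by (auto elim: Ints_cases)
    then have k: "(\<Sum>j<n. of_int (a j) * x j) + of_int (a n) * t = of_int k"
      by simp
    have an: "a n \<noteq> 0"
    proof
      assume "a n = 0"
      then have "(\<Sum>j<n. of_int (a j) * x j) \<in> \<int>" using k by simp
      then have "\<forall>j<n. a j = 0" using assms independent_mod_1D by blast
      then show False using a(2) \<open>a n = 0\<close> by (auto simp: less_Suc_eq)
    qed
    have "t = (of_int k - (\<Sum>j<n. of_int (a j) * x j)) / of_int (a n)"
      using k an by (simp add: field_simps)
    also have "\<dots> = ?h (k, a n, map a [0..<n])"
      by simp
    finally show ?thesis by blast
  qed
  then have "{t. \<not> independent_mod_1 (Suc n) (x(n := t))} \<subseteq> range ?h" by blast
  then show ?thesis by (rule countable_subset) simp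
qed

lemma exists_independent_points:
  assumes "\<And>j. j < n \<Longrightarrow> u j < v j"
  shows "\<exists>x. independent_mod_1 n x \<and> (\<forall>j<n. x j \<in> {u j<..<v j})"
  using assms
proof (induction n)
  case 0
  then show ?case by (simp add: independent_mod_1_def)
next
  case (Suc n)
  then obtain x where x: "independent_mod_1 n x" "\<forall>j<n. x j \<in> {u j<..<v j}"
    by (meson less_Suc_eq)
  have "\<not> {u n<..<v n} \<subseteq> {t. \<not> independent_mod_1 (Suc n) (x(n := t))}"
    using Suc.prems[of n] countable_dependent_extensions[OF x(1)] uncountable_open_interval
      countable_subset by blast
  then obtain t where "t \<in> {u n<..<v n}" "independent_mod_1 (Suc n) (x(n := t))"
    by blast
  with x(2) show ?case
    by (intro exI[of _ "x(n := t)"]) (auto simp: less_Suc_eq simp del: fun_upd_apply, auto)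
qed

text \<open>A relation between the differences is a relation between \<open>t\<close> and the \<open>x j\<close>, in which the
  coefficient of \<open>t\<close> is the sum of all coefficients.\<close>

lemma independent_mod_1_differences:
  assumes "independent_mod_1 (Suc n) (x(n := t))"
  shows "independent_mod_1 n (\<lambda>j. t - x j)"
  unfolding independent_mod_1_def
proof (intro allI impI)
  fix a :: "nat \<Rightarrow> int" and j
  assume a: "(\<Sum>j<n. of_int (a j) * (t - x j)) \<in> \<int>" and j: "j < n"
  let ?b = "\<lambda>j. if j = n then (\<Sum>i<n. a i) else - a j"
  have "(\<Sum>j<Suc n. of_int (?b j) * (x(n := t)) j) = (\<Sum>j<n. of_int (a j) * (t - x j))"
    by (simp add: right_diff_distrib sum_subtractf sum_negf sum_distrib_right)
  then have "(\<Sum>j<Suc n. of_int (?b j) * (x(n := t)) j) \<in> \<int>" using a by simp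
  from independent_mod_1D[OF assms this, of j] show "a j = 0" using j by simp
qed

lemma independent_mod_1_not_Ints:
  assumes "independent_mod_1 n y" "j < n"
  shows "y j \<notin> \<int>"
proof
  assume "y j \<in> \<int>"
  moreover have "(\<Sum>i<n. of_int (if i = j then 1 else 0) * y i) = y j"
    using assms(2) by (simp add: if_distrib[of of_int] if_distrib[of "\<lambda>x. x * _"] cong: if_cong)
  ultimately show False
    using independent_mod_1D[OF assms(1), of "\<lambda>i. if i = j then 1 else 0" j] assms(2) by simp
qed

text \<open>Independence of the family modulo 1 means that its members are distinct, differ from 1, and form
  together with 1 a set that is independent over the integers. This is the hypothesis under which the theorem
  of Kronecker provides an integer multiplier, and not only a real one.\<close>

lemma Kronecker_mod_1:
  fixes \<alpha> :: "nat \<Rightarrow> real"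
  assumes y: "independent_mod_1 n y" and "\<epsilon> > 0"
  obtains k m where "\<And>j. j < n \<Longrightarrow> \<bar>of_int k * y j - of_int (m j) - \<alpha> j\<bar> < \<epsilon>"
proof -
  interpret Modules.module "(\<lambda>r. (*) (real_of_int r))"
    by (simp add: Modules.module.intro distrib_left mult.commute)
  define \<theta> where "\<theta> = y(n := 1)"
  have inj: "inj_on \<theta> {..n}"
  proof (rule inj_onI, rule ccontr)
    have *: False if "i < n" "j \<le> n" "i \<noteq> j" "\<theta> i = \<theta> j" for i j
    proof -
      let ?a = "\<lambda>l. if l = i then 1 else if l = j then -1 else 0 :: int"
      have "(\<Sum>l<n. of_int (?a l) * y l)
          = (\<Sum>l<n. if l = i then y l else 0) - (\<Sum>l<n. if l = j then y l else 0)"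
        unfolding sum_subtractf[symmetric] using \<open>i \<noteq> j\<close> by (intro sum.cong) auto
      also have "\<dots> = y i - (if j < n then y j else 0)"
        using that(1) by simp
      also have "\<dots> \<in> \<int>"
        using that by (auto simp: \<theta>_def)
      finally show False
        using independent_mod_1D[OF y _ that(1), of ?a] by simp
    qed
    fix i j assume "i \<in> {..n}" "j \<in> {..n}" "\<theta> i = \<theta> j" "i \<noteq> j"
    then show False using *[of i j] *[of j i] by (cases "i = n") auto
  qed
  have "independent (\<theta> ` {..n})"
    unfolding dependent_explicit
  proof safe
    fix t :: "real set" and u v
    assume t: "finite t" "t \<subseteq> \<theta> ` {..n}" "(\<Sum>v\<in>t. real_of_int (u v) * v) = 0"
      and v: "v \<in> t" "u v \<noteq> 0"
    define w where "w v = (if v \<in> t then u v else 0)" for v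
    have "0 = (\<Sum>v\<in>\<theta> ` {..n}. real_of_int (w v) * v)"
      unfolding t(3)[symmetric] using t(2) by (intro sum.mono_neutral_cong_left) (auto simp: w_def)
    also have "\<dots> = (\<Sum>j\<le>n. real_of_int (w (\<theta> j)) * \<theta> j)"
      using sum.reindex[OF inj] by simp
    also have "\<dots> = (\<Sum>j<n. real_of_int (w (\<theta> j)) * y j) + of_int (w (\<theta> n))"
      unfolding lessThan_Suc_atMost[symmetric] by (simp add: \<theta>_def)
    finally have eq: "(\<Sum>j<n. real_of_int (w (\<theta> j)) * y j) = - of_int (w (\<theta> n))"
      by simp
    then have 0: "w (\<theta> j) = 0" if "j < n" for j
      using independent_mod_1D[OF y, of "\<lambda>j. w (\<theta> j)"] that by simp
    then have "w (\<theta> n) = 0" using eq by simp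
    with 0 have "w (\<theta> j) = 0" if "j \<le> n" for j using that by (cases "j = n") auto
    then show False using v t(2) by (force simp: w_def)
  qed
  from Kronecker_thm_2[OF this inj _ \<open>\<epsilon> > 0\<close>, of \<alpha>] show ?thesis
    using that by (auto simp: \<theta>_def)
qed


section \<open>Averages of Dirac masses with a large maximal function\<close>

text \<open>The closed form of the Dirichlet kernel, multiplied out so that it also holds at the integers.\<close>

lemma dirichlet_kernel_times_sin:
  "dirichlet_kernel N (abs_torus y) * of_real (sin (pi * y)) = of_real (sin ((2 * real N + 1) * pi * y))"
proof (induction N)
  case 0
  have "e_torus 0 (abs_torus y) = 1" by (simp add: e_torus.abs_eq)
  then show ?case by (simp add: dirichlet_kernel_def)
next
  case (Suc N)
  define s where "s = (real N + 1) * (2 * pi * y)"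
  have e: "e_torus (int (Suc N)) (abs_torus y) = cis s" "e_torus (- int (Suc N)) (abs_torus y) = cis (- s)"
    unfolding cis_conv_exp by (simp_all add: e_torus.abs_eq s_def algebra_simps)
  have "{- int (Suc N)..int (Suc N)} = insert (int (Suc N)) (insert (- int (Suc N)) {- int N..int N})"
    by auto
  then have "dirichlet_kernel (Suc N) (abs_torus y)
      = cis s + cis (- s) + dirichlet_kernel N (abs_torus y)"
    unfolding dirichlet_kernel_def e[symmetric] by simp
  also have "cis s + cis (- s) = of_real (2 * cos s)"
    by (simp add: complex_eq_iff)
  finally have "dirichlet_kernel (Suc N) (abs_torus y) * of_real (sin (pi * y))
      = of_real (2 * cos s * sin (pi * y) + sin ((2 * real N + 1) * pi * y))"
    using Suc.IH by (simp add: algebra_simps)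
  also have "2 * cos s * sin (pi * y) + sin ((2 * real N + 1) * pi * y)
      = sin ((2 * real (Suc N) + 1) * pi * y)"
  proof -
    have "(2 * real (Suc N) + 1) * pi * y = s + pi * y" "(2 * real N + 1) * pi * y = s - pi * y"
      by (simp_all add: s_def algebra_simps)
    then show ?thesis by (simp add: sin_add sin_diff)
  qed
  finally show ?case .
qed

lemma sin_pi_eq_0_iff: "sin (pi * y) = 0 \<longleftrightarrow> y \<in> \<int>"
  by (auto simp: sin_zero_iff_int2 Ints_def mult.commute)

text \<open>The numerators \<open>sin ((2N+1) \<pi> y\<^sub>j)\<close> can be prescribed approximately and simultaneously, since
  \<open>(2N+1) \<pi> y\<^sub>j\<close> modulo \<open>2\<pi>\<close> depends on \<open>N y\<^sub>j\<close> modulo 1 only. They are steered towards the signs of the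
  denominators \<open>sin (\<pi> y\<^sub>j)\<close>.\<close>

lemma dirichlet_kernel_sum_large:
  assumes y: "independent_mod_1 n y"
  shows "\<exists>N. cmod (\<Sum>j<n. dirichlet_kernel N (abs_torus (y j)))
             \<ge> (\<Sum>j<n. 1 / \<bar>sin (pi * y j)\<bar>) / 2"
proof -
  define s where "s j = sgn (sin (pi * y j))" for j
  have nz: "sin (pi * y j) \<noteq> 0" if "j < n" for j
    using independent_mod_1_not_Ints[OF y that] by (simp add: sin_pi_eq_0_iff)
  \<comment> \<open>The target makes \<open>(2k+1) \<pi> y\<^sub>j\<close> close to \<open>s\<^sub>j \<pi>/2\<close> modulo \<open>2\<pi>\<close>; the error 1/6 becomes an angle of at
    most \<open>\<pi>/3\<close>, whose cosine is at least 1/2.\<close>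
  obtain k m where km: "\<And>j. j < n \<Longrightarrow> \<bar>of_int k * y j - of_int (m j) - (s j / 4 - y j / 2)\<bar> < 1/6"
    using Kronecker_mod_1[OF y, of "1/6" "\<lambda>j. s j / 4 - y j / 2"] by auto
  define r where "r j = sin ((2 * of_int k + 1) * pi * y j) / sin (pi * y j)" for j
  have r: "r j \<ge> 1 / \<bar>sin (pi * y j)\<bar> / 2" if j: "j < n" for j
  proof -
    define d where "d = 2 * pi * (of_int k * y j - of_int (m j) - (s j / 4 - y j / 2))"
    have "\<bar>d\<bar> = 2 * pi * \<bar>of_int k * y j - of_int (m j) - (s j / 4 - y j / 2)\<bar>"
      by (simp add: d_def abs_mult)
    also have "\<dots> \<le> 2 * pi * (1/6)"
      using km[OF j] by (intro mult_left_mono) auto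
    finally have d: "\<bar>d\<bar> \<le> pi / 3" by simp
    have "cos (pi / 3) \<le> cos \<bar>d\<bar>"
      using d by (intro cos_monotone_0_pi_le) auto
    then have cd: "cos d \<ge> 1/2" by (simp add: cos_60)
    have sj: "s j = 1 \<or> s j = -1" using nz[OF j] by (auto simp: s_def sgn_if)
    have "(2 * of_int k + 1) * pi * y j = d + s j * (pi / 2) + 2 * pi * of_int (m j)"
      by (simp add: d_def algebra_simps)
    then have "sin ((2 * of_int k + 1) * pi * y j) = sin (d + s j * (pi / 2) + 2 * pi * of_int (m j))"
      by simp
    also have "\<dots> = sin (d + s j * (pi / 2))"
      by (simp add: sin_add sin_int_2pin cos_int_2pin)
    also have "\<dots> = s j * cos d" using sj by (auto simp: sin_add)
    finally have "r j = cos d / \<bar>sin (pi * y j)\<bar>"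
      using nz[OF j] by (auto simp: r_def s_def sgn_if)
    also have "\<dots> \<ge> (1/2) / \<bar>sin (pi * y j)\<bar>"
      by (intro divide_right_mono cd) auto
    finally show ?thesis by simp
  qed
  \<comment> \<open>The integer \<open>k\<close> may be negative; replacing it by \<open>-k-1\<close> changes the sign of \<open>2k+1\<close> and thus of all
    numerators simultaneously.\<close>
  define N where "N = (if k \<ge> 0 then nat k else nat (- k - 1))"
  define \<sigma> :: real where "\<sigma> = (if k \<ge> 0 then 1 else -1)"
  have N: "2 * real N + 1 = \<sigma> * (2 * of_int k + 1)"
    by (auto simp: N_def \<sigma>_def)
  have "dirichlet_kernel N (abs_torus (y j)) = of_real (\<sigma> * r j)" if j: "j < n" for j
  proof -
    have "sin ((2 * real N + 1) * pi * y j) = \<sigma> * sin ((2 * of_int k + 1) * pi * y j)"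
    proof -
      have "sin ((2 * real N + 1) * pi * y j) = sin (\<sigma> * ((2 * of_int k + 1) * pi * y j))"
        by (simp only: N mult.assoc)
      then show ?thesis by (cases "k \<ge> 0") (simp_all only: \<sigma>_def if_True if_False mult_1 mult_minus1 sin_minus)
    qed
    then have "dirichlet_kernel N (abs_torus (y j)) * of_real (sin (pi * y j))
        = of_real (\<sigma> * r j * sin (pi * y j))"
      using nz[OF j] unfolding dirichlet_kernel_times_sin by (simp add: r_def)
    then show ?thesis using nz[OF j] by simp
  qed
  then have "(\<Sum>j<n. dirichlet_kernel N (abs_torus (y j))) = of_real (\<sigma> * (\<Sum>j<n. r j))"
    by (simp add: sum_distrib_left)
  then have "cmod (\<Sum>j<n. dirichlet_kernel N (abs_torus (y j))) = \<bar>\<sigma> * (\<Sum>j<n. r j)\<bar>"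
    by (simp only: norm_of_real)
  also have "\<dots> = \<bar>\<Sum>j<n. r j\<bar>"
    by (simp add: abs_mult \<sigma>_def)
  also have "\<dots> \<ge> (\<Sum>j<n. 1 / \<bar>sin (pi * y j)\<bar>) / 2"
    using sum_mono[of "{..<n}" "\<lambda>j. 1 / \<bar>sin (pi * y j)\<bar> / 2" r] r
    by (simp add: sum_divide_distrib)
  finally show ?thesis by blast
qed

lemma abs_sin_pi_le: "\<bar>sin (pi * s)\<bar> \<le> pi * \<bar>s - of_int m\<bar>"
proof -
  have "sin (pi * s) = sin (pi * (s - of_int m) + pi * of_int m)" by (simp add: algebra_simps)
  also have "\<dots> = sin (pi * (s - of_int m)) * cos (pi * of_int m)"
    using sin_pi_eq_0_iff[of "of_int m"] by (simp add: sin_add)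
  finally have "\<bar>sin (pi * s)\<bar> = \<bar>sin (pi * (s - of_int m))\<bar> * \<bar>cos (pi * of_int m)\<bar>"
    by (simp add: abs_mult)
  also have "\<dots> \<le> \<bar>pi * (s - of_int m)\<bar> * 1"
    by (intro mult_mono abs_sin_x_le_abs_x abs_cos_le_one) auto
  finally show ?thesis by (simp add: abs_mult)
qed

text \<open>On the circle, the points \<open>x\<^sub>j\<close> lie within \<open>1/n, 2/n, \<dots>, n/n\<close> of \<open>t\<close>, when they are visited
  cyclically, starting with the cell that contains \<open>t\<close> and going backwards.\<close>

lemma sum_inverse_sin_ge_harm:
  assumes n: "n > 0" and t: "0 \<le> t" "t < 1"
    and x: "\<And>j. j < n \<Longrightarrow> x j \<in> {real j / n<..<(real j + 1) / n}"
    and nz: "\<And>j. j < n \<Longrightarrow> t - x j \<notin> \<int>"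
  shows "(\<Sum>j<n. 1 / \<bar>sin (pi * (t - x j))\<bar>) \<ge> n / pi * harm n"
proof -
  define i where "i = nat \<lfloor>n * t\<rfloor>"
  have i: "real i \<le> n * t" "n * t < real i + 1"
    using t by (auto simp: i_def)
  have "n * t < n" using n t by simp
  then have "i < n" using i(1) by linarith
  \<comment> \<open>The number of cells from that of \<open>x\<^sub>j\<close> up to that of \<open>t\<close>, counted cyclically; the map \<open>d\<close> is an
    involution of \<open>{..<n}\<close>.\<close>
  define d where "d j = (if j \<le> i then i - j else i + n - j)" for j
  have term_ge: "1 / \<bar>sin (pi * (t - x j))\<bar> \<ge> n / pi * inverse (real (d j + 1))" if j: "j < n" for j
  proof -
    define m :: int where "m = (if j \<le> i then 0 else -1)"
    have xj: "real j < n * x j" "n * x j < real j + 1"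
      using x[OF j] n by (auto simp: field_simps)
    have "n * \<bar>t - x j - of_int m\<bar> = \<bar>n * t - n * x j - real n * of_int m\<bar>"
      using abs_mult[of "real n" "t - x j - of_int m"] by (simp only: right_diff_distrib abs_of_nat)
    also have "\<dots> \<le> real (d j + 1)"
      using xj i j by (auto simp: d_def m_def)
    finally have "\<bar>t - x j - of_int m\<bar> \<le> real (d j + 1) / n"
      using n by (simp add: field_simps)
    then have "\<bar>sin (pi * (t - x j))\<bar> \<le> pi * (real (d j + 1) / n)"
      using abs_sin_pi_le[of "t - x j" m] by (smt (verit) mult_left_mono pi_ge_zero)
    moreover have "\<bar>sin (pi * (t - x j))\<bar> > 0"
      using nz[OF j] sin_pi_eq_0_iff by auto
    ultimately have "1 / (pi * (real (d j + 1) / n)) \<le> 1 / \<bar>sin (pi * (t - x j))\<bar>"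
      using n by (intro divide_left_mono mult_pos_pos divide_pos_pos) auto
    then show ?thesis using n by (simp add: field_simps)
  qed
  have "(\<Sum>j<n. inverse (real (d j + 1))) = (\<Sum>k<n. inverse (real (k + 1)))"
    by (rule sum.reindex_bij_witness[of _ d d]) (use \<open>i < n\<close> in \<open>auto simp: d_def\<close>)
  also have "\<dots> = harm n"
    unfolding harm_def by (rule sum.reindex_bij_witness[of _ "\<lambda>k. k - 1" Suc]) auto
  finally have "n / pi * harm n = (\<Sum>j<n. n / pi * inverse (real (d j + 1)))"
    by (metis sum_distrib_left)
  also have "\<dots> \<le> (\<Sum>j<n. 1 / \<bar>sin (pi * (t - x j))\<bar>)"
    by (intro sum_mono term_ge) auto
  finally show ?thesis .
qed

lemma abs_torus_frac_rep: "abs_torus (frac (rep_torus x)) = x"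
  by (metis (no_types, lifting) frac_def Ints_of_int Quotient_torus Quotient_abs_rep
        abs_torus_eq_iff add_diff_cancel_left' diff_diff_eq2 diff_add_cancel
        Ints_minus minus_diff_eq)

lemma countable_null_sets_torus:
  assumes "countable A"
  shows "A \<in> null_sets torus_measure"
proof -
  have "abs_torus -` A \<subseteq> (\<Union>x\<in>A. range (\<lambda>k :: int. rep_torus x + of_int k))"
  proof
    fix t assume "t \<in> abs_torus -` A"
    moreover have "t - rep_torus (abs_torus t) \<in> \<int>"
      by (metis Quotient_abs_rep Quotient_torus abs_torus_eq_iff)
    then obtain k where "t = rep_torus (abs_torus t) + of_int k"
      by (metis Ints_cases add.commute diff_add_cancel)
    ultimately show "t \<in> (\<Union>x\<in>A. range (\<lambda>k :: int. rep_torus x + of_int k))" by blast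
  qed
  moreover have "countable (\<Union>x\<in>A. range (\<lambda>k :: int. rep_torus x + of_int k))"
    using assms by auto
  ultimately have "countable (abs_torus -` A)" using countable_subset by blast
  then have "abs_torus -` A \<in> null_sets lebesgue"
    using countable_imp_null_set_lborel null_sets_completionI by blast
  then have A: "A \<in> sets torus_measure" "emeasure lebesgue (abs_torus -` A) = 0"
    by (auto simp: sets_torus_measure null_sets_def)
  have "emeasure torus_measure A \<le> emeasure lebesgue (abs_torus -` A)"
    unfolding emeasure_torus_measure[OF A(1)] using A(1)
    by (intro emeasure_mono) (auto simp: sets_torus_measure)
  then show ?thesis using A by auto
qed

text \<open>The quotient below is the partial sum, at \<open>x\<close>, of the Fourier series of the average of the Dirac masses at
  the points \<open>p j\<close>.\<close>

lemma dirac_average_maximal_function_large: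
  "\<exists>n p. n > 0 \<and>
     (AE x in torus_measure. \<exists>N. cmod ((\<Sum>j<n. dirichlet_kernel N (x - p j)) / of_nat n) > C)"
proof -
  obtain n where n: "harm n > 2 * pi * \<bar>C\<bar>"
    using filterlim_at_top_dense[THEN iffD1, OF harm_at_top] eventually_happens'[OF sequentially_bot]
    by metis
  then have "n > 0" by (cases n) (auto simp: harm_def mult_less_0_iff)
  define I where "I j = {real j / n<..<(real j + 1) / n}" for j
  obtain x where x: "independent_mod_1 n x" "\<And>j. j < n \<Longrightarrow> x j \<in> I j"
    using exists_independent_points[of n "\<lambda>j. real j / n" "\<lambda>j. (real j + 1) / n"] \<open>n > 0\<close>
    unfolding I_def by (auto simp: divide_strict_right_mono)
  define G where "G = abs_torus ` {t. \<not> independent_mod_1 (Suc n) (x(n := t))}"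
  have "AE z in torus_measure. z \<notin> G"
    unfolding G_def using countable_dependent_extensions[OF x(1)]
    by (intro AE_not_in countable_null_sets_torus) auto
  moreover have "\<exists>N. cmod ((\<Sum>j<n. dirichlet_kernel N (z - abs_torus (x j))) / of_nat n) > C"
    if "z \<notin> G" for z
  proof -
    define t where "t = frac (rep_torus z)"
    have t: "0 \<le> t" "t < 1" "z = abs_torus t"
      by (auto simp: t_def frac_lt_1 abs_torus_frac_rep)
    have ind: "independent_mod_1 n (\<lambda>j. t - x j)"
      using that unfolding t(3) G_def by (intro independent_mod_1_differences) blast
    obtain N where "cmod (\<Sum>j<n. dirichlet_kernel N (abs_torus (t - x j)))
        \<ge> (\<Sum>j<n. 1 / \<bar>sin (pi * (t - x j))\<bar>) / 2"
      using dirichlet_kernel_sum_large[OF ind] by auto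
    moreover have "(\<Sum>j<n. 1 / \<bar>sin (pi * (t - x j))\<bar>) \<ge> n / pi * harm n"
      using x(2) independent_mod_1_not_Ints[OF ind]
      by (intro sum_inverse_sin_ge_harm) (auto simp: \<open>n > 0\<close> t I_def)
    moreover have "n / pi * harm n > n / pi * (2 * pi * \<bar>C\<bar>)"
      using n \<open>n > 0\<close> by (intro mult_strict_left_mono) auto
    ultimately have "cmod (\<Sum>j<n. dirichlet_kernel N (abs_torus (t - x j))) > n * \<bar>C\<bar>"
      by simp
    then have "cmod (\<Sum>j<n. dirichlet_kernel N (z - abs_torus (x j))) > n * \<bar>C\<bar>"
      by (simp add: t(3) minus_torus.abs_eq)
    then have "cmod ((\<Sum>j<n. dirichlet_kernel N (z - abs_torus (x j))) / of_nat n) > \<bar>C\<bar>"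
      using \<open>n > 0\<close> by (simp add: norm_divide field_simps)
    then show ?thesis by (intro exI[of _ N]) linarith
  qed
  ultimately have "AE z in torus_measure.
      \<exists>N. cmod ((\<Sum>j<n. dirichlet_kernel N (z - abs_torus (x j))) / of_nat n) > C"
    by (auto elim: eventually_mono)
  with \<open>n > 0\<close> show ?thesis by (intro exI[of _ n] exI[of _ "\<lambda>j. abs_torus (x j)"]) simp
qed


section \<open>Continuity of the partial sums and integrable functions close to Dirac masses\<close>

lemma frac_rep_abs_torus: "frac (rep_torus (abs_torus t)) = frac t"
proof -
  have "rep_torus (abs_torus t) - t \<in> \<int>"
    by (metis Quotient_abs_rep Quotient_torus abs_torus_eq_iff)
  then obtain k where "rep_torus (abs_torus t) - t = of_int k" by (auto elim: Ints_cases)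
  then have "rep_torus (abs_torus t) = t + of_int k" by simp
  then show ?thesis by (simp add: frac_def)
qed

lemma integrable_times_e_torus:
  assumes "integrable torus_measure f"
  shows "integrable torus_measure (\<lambda>x. f x * e_torus n x)"
proof -
  have [measurable]: "f \<in> borel_measurable torus_measure" using assms by auto
  show ?thesis
    by (rule Bochner_Integration.integrable_bound[OF assms]) (auto simp: norm_mult)
qed

lemma linear_fourier_coeff: "linear (\<lambda>f. fourier_coeff f n)"
proof
  fix f g :: torus_L1 and c :: real
  show "fourier_coeff (f + g) n = fourier_coeff f n + fourier_coeff g n"
    by transfer (simp add: distrib_right integrable_times_e_torus)
  show "fourier_coeff (c *\<^sub>R f) n = c *\<^sub>R fourier_coeff f n"
    by transfer simp
qed

lemma norm_fourier_coeff_le: "cmod (fourier_coeff f n) \<le> norm f"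
proof (transfer fixing: n)
  fix f :: "torus \<Rightarrow> complex"
  have "cmod (\<integral>x. f x * e_torus (- n) x \<partial>torus_measure)
      \<le> (\<integral>x. cmod (f x * e_torus (- n) x) \<partial>torus_measure)"
    by (rule integral_norm_bound)
  then show "cmod (\<integral>x. f x * e_torus (- n) x \<partial>torus_measure) \<le> (\<integral>x. cmod (f x) \<partial>torus_measure)"
    by (simp add: norm_mult)
qed

lemma linear_fourier_partial_sum: "linear (\<lambda>f. fourier_partial_sum N f x)"
  unfolding fourier_partial_sum_eq
  by (intro linear_compose_sum ballI)
     (auto intro!: linearI simp: linear_add[OF linear_fourier_coeff]
       linear_scale[OF linear_fourier_coeff] algebra_simps)

lemma norm_fourier_partial_sum_le:
  "cmod (fourier_partial_sum N f x) \<le> (2 * real N + 1) * norm f"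
proof -
  have "cmod (fourier_partial_sum N f x) \<le> (\<Sum>n\<in>{- int N..int N}. norm f)"
    unfolding fourier_partial_sum_eq
    by (intro sum_norm_le) (simp add: norm_mult norm_fourier_coeff_le)
  then show ?thesis by simp
qed

lemma borel_measurable_fourier_partial_sum [measurable]:
  "fourier_partial_sum N f \<in> borel_measurable torus_measure"
  unfolding fourier_partial_sum_eq[abs_def] by measurable

text \<open>The fractional part selects the representative in \<open>[0, 1)\<close>, so that \<open>bump \<delta>\<close> is the normalised
  indicator function of the arc from 0 to \<open>\<delta>\<close>.\<close>

definition bump :: "real \<Rightarrow> torus \<Rightarrow> real" where
  "bump \<delta> y = indicator {..<\<delta>} (frac (rep_torus y)) / \<delta>"

lemma borel_measurable_bump [measurable]: "bump \<delta> \<in> borel_measurable torus_measure"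
proof (rule borel_measurable_torusI)
  have "(\<lambda>t. indicator {..<\<delta>} (t - of_int \<lfloor>t\<rfloor>) / \<delta>) \<in> borel_measurable borel"
    by measurable
  then show "(\<lambda>t. bump \<delta> (abs_torus t)) \<in> borel_measurable lebesgue"
    unfolding bump_def frac_rep_abs_torus unfolding frac_def
    by (intro measurable_completion) simp
qed

lemma bump_nonneg: "\<delta> > 0 \<Longrightarrow> bump \<delta> y \<ge> 0"
  by (simp add: bump_def)

lemma integrable_bump:
  assumes "\<delta> > 0"
  shows "integrable torus_measure (bump \<delta>)"
proof (rule finite_measure.integrable_const_bound[OF finite_torus_measure])
  show "AE y in torus_measure. norm (bump \<delta> y) \<le> 1 / \<delta>"
    using assms by (auto simp: bump_def indicator_def)
qed measurable

lemma integral_bump: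
  assumes "0 < \<delta>" "\<delta> \<le> 1"
  shows "(\<integral>y. bump \<delta> y \<partial>torus_measure) = 1"
proof -
  define A where "A = {y. frac (rep_torus y) < \<delta>}"
  have eq: "bump \<delta> y = indicator A y / \<delta>" for y
    by (simp add: bump_def A_def indicator_def)
  have "A = {y \<in> space torus_measure. bump \<delta> y > 0}"
    using assms by (auto simp: eq indicator_def)
  also have "\<dots> \<in> sets torus_measure" by measurable
  finally have A: "A \<in> sets torus_measure" .
  have "abs_torus -` A \<inter> {0..<1} = {0..<\<delta>}"
    using assms by (auto simp: A_def frac_rep_abs_torus frac_eq[THEN iffD2])
  then have "emeasure torus_measure A = emeasure lebesgue {0..<\<delta>}"
    by (simp add: emeasure_torus_measure[OF A])
  then have "measure torus_measure A = \<delta>"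
    using assms by (simp add: measure_def)
  then show ?thesis using assms A by (simp add: eq)
qed

lemma norm_e_torus_minus_1_le:
  assumes "bump \<delta> y \<noteq> 0"
  shows "cmod (e_torus n y - 1) \<le> 2 * pi * \<bar>of_int n\<bar> * \<delta>"
proof -
  define t where "t = frac (rep_torus y)"
  have t: "y = abs_torus t" "0 \<le> t" "t < \<delta>"
    using assms by (auto simp: t_def abs_torus_frac_rep bump_def indicator_def split: if_splits)
  have "e_torus n y = exp (\<i> * of_real (2 * pi * t * of_int n))"
    by (simp add: t(1) e_torus.abs_eq mult_ac)
  then have "cmod (e_torus n y - 1) \<le> \<bar>2 * pi * t * of_int n\<bar>"
    using dist_exp_i_1[of "2 * pi * t * of_int n"] abs_sin_x_le_abs_x[of "2 * pi * t * of_int n / 2"]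
    by (simp only: abs_divide)
  also have "\<dots> = 2 * pi * \<bar>of_int n\<bar> * t" using t by (simp add: abs_mult)
  also have "\<dots> \<le> 2 * pi * \<bar>of_int n\<bar> * \<delta>"
    using t by (intro mult_left_mono) auto
  finally show ?thesis .
qed

lemma bump_fourier_near_1:
  assumes "0 < \<delta>" "\<delta> \<le> 1"
  shows "cmod ((\<integral>y. of_real (bump \<delta> y) * e_torus n y \<partial>torus_measure) - 1) \<le> 2 * pi * \<bar>of_int n\<bar> * \<delta>"
proof -
  let ?c = "2 * pi * \<bar>of_int n\<bar> * \<delta>"
  note int = integrable_bump[OF assms(1)]
  have intc: "integrable torus_measure (\<lambda>y. complex_of_real (bump \<delta> y))"
    using int by simp
  have "(\<integral>y. complex_of_real (bump \<delta> y) \<partial>torus_measure) = 1"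
    using integral_bump[OF assms] by simp
  then have "(\<integral>y. of_real (bump \<delta> y) * e_torus n y \<partial>torus_measure) - 1
      = (\<integral>y. of_real (bump \<delta> y) * e_torus n y - of_real (bump \<delta> y) \<partial>torus_measure)"
    using intc integrable_times_e_torus[OF intc] by simp
  also have "cmod \<dots> \<le> (\<integral>y. cmod (of_real (bump \<delta> y) * e_torus n y - of_real (bump \<delta> y)) \<partial>torus_measure)"
    by (rule integral_norm_bound)
  also have "\<dots> \<le> (\<integral>y. bump \<delta> y * ?c \<partial>torus_measure)"
  proof (rule integral_mono)
    fix y
    have "cmod (of_real (bump \<delta> y) * e_torus n y - of_real (bump \<delta> y))
        = cmod (of_real (bump \<delta> y) * (e_torus n y - 1))"
      by (simp add: algebra_simps)
    also have "\<dots> = bump \<delta> y * cmod (e_torus n y - 1)"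
      using bump_nonneg[OF assms(1), of y] by (simp only: norm_mult norm_of_real abs_of_nonneg)
    also have "\<dots> \<le> bump \<delta> y * ?c"
      using norm_e_torus_minus_1_le[of \<delta> y n] bump_nonneg[OF assms(1), of y]
      by (cases "bump \<delta> y = 0") (auto intro: mult_left_mono)
    finally show "cmod (of_real (bump \<delta> y) * e_torus n y - of_real (bump \<delta> y)) \<le> bump \<delta> y * ?c" .
  qed (use int intc integrable_times_e_torus[OF intc] in auto)
  also have "\<dots> = ?c" using integral_bump[OF assms] by simp
  finally show ?thesis .
qed

lemma integral_torus_reflect:
  fixes f :: "torus \<Rightarrow> 'a :: {banach, second_countable_topology}"
  assumes [measurable]: "f \<in> borel_measurable torus_measure"
  shows "(\<integral>y. f (x - y) \<partial>torus_measure) = (\<integral>y. f y \<partial>torus_measure)"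
  using integral_distr[OF measurable_torus_reflect assms, of x]
  by (simp add: distr_torus_measure_reflect)

text \<open>The witness is \<open>y \<mapsto> bump \<delta> (p - y)\<close>: a reflection about \<open>p\<close> keeps the norm, since it preserves the
  measure, and multiplies the \<open>n\<close>-th coefficient of the reflected bump, which is close to 1, by \<open>e(-np)\<close>.\<close>

lemma exists_L1_near_dirac:
  assumes "0 < \<delta>" "\<delta> \<le> 1"
  obtains g where "norm g = 1"
    "\<And>n. cmod (fourier_coeff g n - e_torus (- n) p) \<le> 2 * pi * \<bar>of_int n\<bar> * \<delta>"
proof -
  let ?b = "\<lambda>y. complex_of_real (bump \<delta> (p - y))"
  note [measurable] = measurable_torus_reflect[of p]
  have [measurable]: "(\<lambda>y. complex_of_real (bump \<delta> y)) \<in> borel_measurable torus_measure" by measurable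
  have "integrable torus_measure (\<lambda>y. bump \<delta> (p - y))"
    using integrable_bump[OF assms(1)] integrable_distr[OF measurable_torus_reflect, of p "bump \<delta>"]
    by (simp add: distr_torus_measure_reflect)
  then have b: "integrable torus_measure ?b" by simp
  define g where "g = abs_torus_L1 ?b"
  have g: "norm g = (\<integral>y. cmod (?b y) \<partial>torus_measure)"
      "fourier_coeff g n = (\<integral>y. ?b y * e_torus (- n) y \<partial>torus_measure)" for n
    unfolding g_def using b by (simp_all add: norm_torus_L1.abs_eq fourier_coeff.abs_eq eq_onp_def)
  have "norm g = (\<integral>y. bump \<delta> (p - y) \<partial>torus_measure)"
    using bump_nonneg[OF assms(1)] by (simp add: g)
  also have "\<dots> = 1" by (subst integral_torus_reflect) (use integral_bump[OF assms] in auto)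
  finally have 1: "norm g = 1" .
  have 2: "cmod (fourier_coeff g n - e_torus (- n) p) \<le> 2 * pi * \<bar>of_int n\<bar> * \<delta>" for n
  proof -
    let ?I = "\<integral>y. of_real (bump \<delta> y) * e_torus n y \<partial>torus_measure"
    have "fourier_coeff g n = (\<integral>y. ?b y * e_torus (- n) (p - (p - y)) \<partial>torus_measure)"
      by (simp add: g)
    also have "\<dots> = (\<integral>y. of_real (bump \<delta> y) * e_torus (- n) (p - y) \<partial>torus_measure)"
      by (rule integral_torus_reflect) measurable
    also have "\<dots> = (\<integral>y. e_torus (- n) p * (of_real (bump \<delta> y) * e_torus n y) \<partial>torus_measure)"
      by (simp add: e_torus_diff mult_ac)
    also have "\<dots> = e_torus (- n) p * ?I" by (rule integral_mult_right_zero)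
    finally have "fourier_coeff g n - e_torus (- n) p = e_torus (- n) p * (?I - 1)"
      by (simp add: algebra_simps)
    then show ?thesis using bump_fourier_near_1[OF assms, of n] by (simp add: norm_mult)
  qed
  from 1 2 show ?thesis by (rule that)
qed

text \<open>Fourier coefficients close to those of the Dirac masses give partial sums that are close uniformly in
  \<open>x\<close>, as long as \<open>N\<close> stays below a fixed \<open>K\<close>.\<close>

lemma exists_L1_near_dirac_average:
  assumes n: "n > 0" and \<epsilon>: "\<epsilon> > 0"
  obtains g where "norm g \<le> 1"
    "\<And>N x. N \<le> K \<Longrightarrow>
       cmod (fourier_partial_sum N g x - (\<Sum>j<n. dirichlet_kernel N (x - p j)) / of_nat n) \<le> \<epsilon>"
proof -
  define \<delta> where "\<delta> = min 1 (\<epsilon> / ((2 * real K + 1) * (2 * pi * (real K + 1))))"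
  have pos: "(2 * real K + 1) * (2 * pi * (real K + 1)) > 0"
    by (intro mult_pos_pos) (auto intro: add_nonneg_pos)
  then have \<delta>: "0 < \<delta>" "\<delta> \<le> 1" using \<epsilon> by (auto simp: \<delta>_def)
  have "\<delta> \<le> \<epsilon> / ((2 * real K + 1) * (2 * pi * (real K + 1)))" by (simp add: \<delta>_def)
  then have \<delta>_le: "(2 * real K + 1) * (2 * pi * (real K + 1) * \<delta>) \<le> \<epsilon>"
    using pos by (simp add: pos_le_divide_eq mult_ac)
  have "\<exists>h. \<forall>j. norm (h j) = 1 \<and>
      (\<forall>m. cmod (fourier_coeff (h j) m - e_torus (- m) (p j)) \<le> 2 * pi * \<bar>of_int m\<bar> * \<delta>)"
    by (intro choice allI) (metis exists_L1_near_dirac[OF \<delta>])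
  then obtain h where h: "\<And>j. norm (h j) = 1"
      "\<And>j m. cmod (fourier_coeff (h j) m - e_torus (- m) (p j)) \<le> 2 * pi * \<bar>of_int m\<bar> * \<delta>"
    by blast
  have near: "cmod (fourier_partial_sum N (h j) x - dirichlet_kernel N (x - p j)) \<le> \<epsilon>"
    if "N \<le> K" for N x j
  proof -
    have "fourier_partial_sum N (h j) x - dirichlet_kernel N (x - p j)
        = (\<Sum>m\<in>{- int N..int N}. (fourier_coeff (h j) m - e_torus (- m) (p j)) * e_torus m x)"
      unfolding fourier_partial_sum_eq dirichlet_kernel_def e_torus_diff sum_subtractf[symmetric]
      by (simp add: algebra_simps)
    also have "cmod \<dots> \<le> (\<Sum>m\<in>{- int N..int N}. 2 * pi * (real K + 1) * \<delta>)"
    proof (intro sum_norm_le)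
      fix m assume m: "m \<in> {- int N..int N}"
      have "cmod ((fourier_coeff (h j) m - e_torus (- m) (p j)) * e_torus m x) \<le> 2 * pi * \<bar>of_int m\<bar> * \<delta>"
        using h(2)[of j m] by (simp add: norm_mult)
      also have "\<bar>of_int m\<bar> \<le> real K + 1" using m that by auto
      then have "2 * pi * \<bar>of_int m\<bar> * \<delta> \<le> 2 * pi * (real K + 1) * \<delta>"
        using \<delta> by (intro mult_right_mono mult_left_mono) auto
      finally show "cmod ((fourier_coeff (h j) m - e_torus (- m) (p j)) * e_torus m x)
          \<le> 2 * pi * (real K + 1) * \<delta>" .
    qed
    also have "\<dots> = (2 * real N + 1) * (2 * pi * (real K + 1) * \<delta>)" by simp
    also have "\<dots> \<le> (2 * real K + 1) * (2 * pi * (real K + 1) * \<delta>)"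
      using that \<delta> by (intro mult_right_mono) auto
    finally show ?thesis using \<delta>_le by linarith
  qed
  define g where "g = (\<Sum>j<n. (1 / real n) *\<^sub>R h j)"
  have "norm g \<le> (\<Sum>j<n. 1 / real n)"
    unfolding g_def by (intro sum_norm_le) (simp add: h)
  then have "norm g \<le> 1" using n by simp
  moreover have "cmod (fourier_partial_sum N g x - (\<Sum>j<n. dirichlet_kernel N (x - p j)) / of_nat n) \<le> \<epsilon>"
    if "N \<le> K" for N x
  proof -
    have "fourier_partial_sum N g x - (\<Sum>j<n. dirichlet_kernel N (x - p j)) / of_nat n
        = (\<Sum>j<n. (1 / real n) *\<^sub>R (fourier_partial_sum N (h j) x - dirichlet_kernel N (x - p j)))"
      unfolding g_def linear_sum[OF linear_fourier_partial_sum]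
        linear_scale[OF linear_fourier_partial_sum]
      by (simp add: sum_subtractf scaleR_diff_right scaleR_sum_right[symmetric] sum_divide_distrib[symmetric]
        scaleR_conv_of_real diff_divide_distrib)
    also have "cmod \<dots> \<le> (\<Sum>j<n. 1 / real n * \<epsilon>)"
      using n near[OF that] by (intro sum_norm_le) (simp add: divide_right_mono)
    also have "\<dots> = \<epsilon>" using n by simp
    finally show ?thesis .
  qed
  ultimately show ?thesis by (rule that)
qed


section \<open>Functions of norm at most 1 with large partial sums\<close>

interpretation torus: finite_measure torus_measure
  by (rule finite_torus_measure)

lemma measure_torus_UNIV: "measure torus_measure UNIV = 1"
  by (simp add: measure_def emeasure_torus_measure_UNIV)

definition bounded_partial_sums_set :: "real \<Rightarrow> torus_L1 \<Rightarrow> torus set" where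
  "bounded_partial_sums_set M f = {x. \<forall>N. cmod (fourier_partial_sum N f x) \<le> M}"

lemma sets_bounded_partial_sums_set [measurable]:
  "bounded_partial_sums_set M f \<in> sets torus_measure"
proof -
  have "{x \<in> space torus_measure. \<forall>N. cmod (fourier_partial_sum N f x) \<le> M} \<in> sets torus_measure"
    by measurable
  then show ?thesis by (simp add: bounded_partial_sums_set_def)
qed

text \<open>The set where the partial sums of the Dirac average with index up to \<open>K\<close> are bounded by \<open>C + 1\<close>
  decreases to a null set as \<open>K\<close> grows. For one large \<open>K\<close> the Dirac masses are then smoothed with an
  error of at most 1.\<close>

lemma exists_small_bounded_partial_sums_set:
  assumes "c > 0"
  shows "\<exists>g. norm g \<le> 1 \<and> measure torus_measure (bounded_partial_sums_set C g) < c"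
proof -
  obtain n p where n: "n > 0"
    and AE: "AE x in torus_measure. \<exists>N. cmod ((\<Sum>j<n. dirichlet_kernel N (x - p j)) / of_nat n) > C + 1"
    using dirac_average_maximal_function_large[of "C + 1"] by blast
  define T where "T N x = (\<Sum>j<n. dirichlet_kernel N (x - p j)) / of_nat n" for N x
  have [measurable]: "T N \<in> borel_measurable torus_measure" for N
    unfolding T_def[abs_def] dirichlet_kernel_def e_torus_diff by measurable
  define A where "A K = {x \<in> space torus_measure. \<forall>N\<le>K. cmod (T N x) \<le> C + 1}" for K :: nat
  have A: "A K \<in> sets torus_measure" for K unfolding A_def by measurable
  have "(\<lambda>K. measure torus_measure (A K)) \<longlonglongrightarrow> measure torus_measure (\<Inter>K. A K)"
    using A by (intro torus.finite_Lim_measure_decseq) (auto simp: decseq_def A_def)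
  moreover have "(\<Inter>K. A K) \<in> null_sets torus_measure"
  proof (rule AE_iff_null_sets[THEN iffD2])
    show "AE x in torus_measure. x \<notin> (\<Inter>K. A K)"
      using AE by eventually_elim (auto simp: A_def T_def not_le)
  qed (use A in auto)
  ultimately have "(\<lambda>K. measure torus_measure (A K)) \<longlonglongrightarrow> 0"
    by (simp add: measure_eq_0_null_sets)
  then have "eventually (\<lambda>K. measure torus_measure (A K) < c) sequentially"
    using assms by (rule order_tendstoD)
  then obtain K where K: "measure torus_measure (A K) < c"
    using eventually_happens'[OF sequentially_bot] by blast
  obtain g where g: "norm g \<le> 1"
    "\<And>N x. N \<le> K \<Longrightarrow> cmod (fourier_partial_sum N g x - T N x) \<le> 1"
    using exists_L1_near_dirac_average[OF n, of 1 K p] unfolding T_def by auto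
  have "bounded_partial_sums_set C g \<subseteq> A K"
  proof
    fix x assume x: "x \<in> bounded_partial_sums_set C g"
    have "cmod (T N x) \<le> C + 1" if "N \<le> K" for N
      using g(2)[OF that, of x] x norm_triangle_sub[of "T N x" "fourier_partial_sum N g x"]
      unfolding bounded_partial_sums_set_def by (smt (verit) mem_Collect_eq norm_minus_commute)
    then show "x \<in> A K" by (simp add: A_def)
  qed
  then have "measure torus_measure (bounded_partial_sums_set C g) \<le> measure torus_measure (A K)"
    by (intro torus.finite_measure_mono A)
  with K g(1) show ?thesis by auto
qed


section \<open>Completeness of the space and its Baire property\<close>

lemma norm_torus_L1_rep:
  "integrable torus_measure (rep_torus_L1 f)"
  "abs_torus_L1 (rep_torus_L1 f) = f"
  "norm f = (\<integral>x. cmod (rep_torus_L1 f x) \<partial>torus_measure)"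
proof -
  have Q: "Quotient (\<lambda>f g. integrable torus_measure f \<and> integrable torus_measure g \<and>
         (AE x in torus_measure. f x = g x)) abs_torus_L1 rep_torus_L1 cr_torus_L1"
    by (rule Quotient_torus_L1)
  show i: "integrable torus_measure (rep_torus_L1 f)" for f
    using Quotient_rep_reflp[OF Q, of f] by simp
  show a: "abs_torus_L1 (rep_torus_L1 f) = f" for f
    using Quotient_abs_rep[OF Q, of f] .
  have n: "norm (abs_torus_L1 h) = (\<integral>x. cmod (h x) \<partial>torus_measure)"
    if "integrable torus_measure h" for h
    using that by (simp add: norm_torus_L1.abs_eq)
  show "norm f = (\<integral>x. cmod (rep_torus_L1 f x) \<partial>torus_measure)"
    using n[OF i[of f]] a by simp
qed

lemma torus_L1_sum_abs:
  fixes f :: "nat \<Rightarrow> torus_L1"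
  shows
  "(\<Sum>i<n. f i) = abs_torus_L1 (\<lambda>x. \<Sum>i<n. rep_torus_L1 (f i) x)"
proof (induction n)
  case 0
  show ?case by (simp add: zero_torus_L1_def)
next
  case (Suc n)
  have "(\<Sum>i<Suc n. f i) = abs_torus_L1 (\<lambda>x. \<Sum>i<n. rep_torus_L1 (f i) x) + abs_torus_L1 (rep_torus_L1 (f n))"
    using Suc norm_torus_L1_rep(2) by simp
  also have "\<dots> = abs_torus_L1 (\<lambda>x. (\<Sum>i<n. rep_torus_L1 (f i) x) + rep_torus_L1 (f n) x)"
    by (intro plus_torus_L1.abs_eq) (auto intro: norm_torus_L1_rep)
  finally show ?case by simp
qed

lemma summable_norm_integral_imp_AE_summable:
  fixes F :: "nat \<Rightarrow> 'a \<Rightarrow> 'b :: {banach, second_countable_topology}"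
  assumes int: "\<And>i. integrable M (F i)" and sum: "summable (\<lambda>i. \<integral>x. norm (F i x) \<partial>M)"
  shows "AE x in M. summable (\<lambda>i. norm (F i x))"
proof -
  have [measurable]: "F i \<in> borel_measurable M" for i using int by auto
  have "(\<integral>\<^sup>+x. (\<Sum>i. ennreal (norm (F i x))) \<partial>M) = (\<Sum>i. \<integral>\<^sup>+x. ennreal (norm (F i x)) \<partial>M)"
    by (intro nn_integral_suminf) auto
  also have "\<dots> = (\<Sum>i. ennreal (\<integral>x. norm (F i x) \<partial>M))"
    by (subst nn_integral_eq_integral) (use int in auto)
  also have "\<dots> \<noteq> \<infinity>"
    by (subst suminf_ennreal2[OF _ sum]) simp_all
  finally have "(\<integral>\<^sup>+x. (\<Sum>i. ennreal (norm (F i x))) \<partial>M) \<noteq> \<infinity>" .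
  then have "AE x in M. (\<Sum>i. ennreal (norm (F i x))) \<noteq> \<infinity>"
    by (intro nn_integral_PInf_AE) auto
  then show ?thesis
    by eventually_elim (intro summable_suminf_not_top; simp)
qed

text \<open>The pointwise sum of representatives exists almost everywhere and is the limit, by dominated convergence
  with the sum of the absolute values as the majorant.\<close>

lemma torus_L1_absolutely_convergent:
  fixes f :: "nat \<Rightarrow> torus_L1"
  assumes "summable (\<lambda>i. norm (f i))"
  shows "convergent (\<lambda>n. \<Sum>i<n. f i)"
proof -
  define F where "F i = rep_torus_L1 (f i)" for i
  have int: "integrable torus_measure (F i)" for i
    by (simp add: F_def norm_torus_L1_rep(1))
  have sum: "summable (\<lambda>i. \<integral>x. cmod (F i x) \<partial>torus_measure)"
    using assms by (simp add: norm_torus_L1_rep(3) F_def)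
  have AE: "AE x in torus_measure. summable (\<lambda>i. cmod (F i x))"
    by (rule summable_norm_integral_imp_AE_summable[OF int sum])
  define S where "S x = (\<Sum>i. F i x)" for x
  have S: "integrable torus_measure S"
    unfolding S_def by (rule integrable_suminf[OF int AE sum])
  have W: "integrable torus_measure (\<lambda>x. \<Sum>i. cmod (F i x))"
    by (rule integrable_suminf) (use int AE sum in auto)
  have intn: "integrable torus_measure (\<lambda>x. \<Sum>i<n. F i x)" for n
    using int by auto
  have "norm ((\<Sum>i<n. f i) - abs_torus_L1 S) = (\<integral>x. cmod ((\<Sum>i<n. F i x) - S x) \<partial>torus_measure)" for n
  proof -
    have "(\<Sum>i<n. f i) - abs_torus_L1 S = abs_torus_L1 (\<lambda>x. (\<Sum>i<n. F i x) - S x)"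
      unfolding torus_L1_sum_abs F_def[symmetric]
      using intn S by (intro minus_torus_L1.abs_eq) auto
    then show ?thesis
      using intn S by (simp add: norm_torus_L1.abs_eq)
  qed
  moreover have "(\<lambda>n. \<integral>x. cmod ((\<Sum>i<n. F i x) - S x) \<partial>torus_measure) \<longlonglongrightarrow> (\<integral>x. 0 \<partial>torus_measure)"
  proof (rule integral_dominated_convergence[OF _ _ W])
    show "AE x in torus_measure. (\<lambda>n. cmod ((\<Sum>i<n. F i x) - S x)) \<longlonglongrightarrow> 0"
      using AE
    proof eventually_elim
      case (elim x)
      then have "(\<lambda>n. \<Sum>i<n. F i x) \<longlonglongrightarrow> S x"
        unfolding S_def by (intro summable_LIMSEQ) (rule summable_norm_cancel)
      then show ?case by (intro tendsto_norm_zero) (simp add: LIM_zero)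
    qed
    show "AE x in torus_measure. norm (cmod ((\<Sum>i<n. F i x) - S x)) \<le> (\<Sum>i. cmod (F i x))" for n
      using AE
    proof eventually_elim
      case (elim x)
      then have s: "summable (\<lambda>i. F i x)" by (rule summable_norm_cancel)
      have s': "summable (\<lambda>i. cmod (F (i + n) x))" using elim by (rule summable_ignore_initial_segment)
      have "(\<Sum>i<n. F i x) - S x = - (\<Sum>i. F (i + n) x)"
        unfolding S_def by (subst suminf_split_initial_segment[OF s, of n]) simp
      then have "cmod ((\<Sum>i<n. F i x) - S x) \<le> (\<Sum>i. cmod (F (i + n) x))"
        using summable_norm[OF s'] by simp
      also have "\<dots> \<le> (\<Sum>i. cmod (F i x))"
        using suminf_split_initial_segment[OF elim, of n] by (simp add: sum_nonneg)
      finally show ?case by simp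
    qed
  qed (use intn S in auto)
  ultimately have "(\<lambda>n. norm ((\<Sum>i<n. f i) - abs_torus_L1 S)) \<longlonglongrightarrow> 0" by simp
  then have "(\<lambda>n. \<Sum>i<n. f i) \<longlonglongrightarrow> abs_torus_L1 S"
    by (simp add: tendsto_norm_zero_iff LIM_zero_iff)
  then show ?thesis by (rule convergentI)
qed

instance torus_L1 :: banach
proof
  fix X :: "nat \<Rightarrow> torus_L1" assume X: "Cauchy X"
  have "\<forall>k. \<exists>M. \<forall>m\<ge>M. \<forall>n\<ge>M. norm (X m - X n) < (1/2) ^ k"
    using CauchyD[OF X] by simp
  then obtain M where M: "\<And>k m n. m \<ge> M k \<Longrightarrow> n \<ge> M k \<Longrightarrow> norm (X m - X n) < (1/2) ^ k"
    unfolding choice_iff by blast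
  \<comment> \<open>Partial sums of \<open>M i + 1\<close>, and not \<open>M\<close> itself, in order to have strict monotonicity besides
    \<open>r k \<ge> M k\<close>.\<close>
  define r where "r k = (\<Sum>i\<le>k. M i + 1)" for k
  have mono: "strict_mono r" by (rule strict_monoI_Suc) (simp add: r_def)
  have rM: "r k \<ge> M k" for k
    unfolding r_def using member_le_sum[of k "{..k}" "\<lambda>i. M i + 1"] by simp
  have step: "norm (X (r (Suc k)) - X (r k)) \<le> (1/2) ^ k" for k
    using M[of k "r (Suc k)" "r k"] rM[of k] strict_monoD[OF mono, of k "Suc k"]
    by (intro less_imp_le) simp
  have "summable (\<lambda>k. norm (X (r (Suc k)) - X (r k)))"
    by (rule summable_comparison_test'[OF summable_geometric[of "1/2"]]) (use step in auto)
  then have "convergent (\<lambda>n. \<Sum>k<n. X (r (Suc k)) - X (r k))"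
    by (rule torus_L1_absolutely_convergent)
  then obtain l where "(\<lambda>n. X (r n) - X (r 0)) \<longlonglongrightarrow> l"
    unfolding sum_lessThan_telescope[of "\<lambda>n. X (r n)"] by (auto simp: convergent_def)
  then have "(\<lambda>n. X (r n) - X (r 0) + X (r 0)) \<longlonglongrightarrow> l + X (r 0)"
    by (intro tendsto_add) auto
  then have "(X \<circ> r) \<longlonglongrightarrow> l + X (r 0)" by (simp add: o_def)
  from Cauchy_converges_subseq[OF X mono this] show "convergent X" by (rule convergentI)
qed

text \<open>If \<open>S\<close> were of the first category, the closures of its nowhere dense pieces and the sets that cover
  the complement would be countably many closed sets with empty interior whose union is the whole space.\<close>

lemma second_category_if_complement_covered:
  fixes S :: "'a :: complete_space set"
  assumes "countable \<F>" and \<F>: "\<And>F. F \<in> \<F> \<Longrightarrow> closed F \<and> interior F = {}"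
    and cover: "- S \<subseteq> \<Union>\<F>"
  shows "second_category S"
  unfolding second_category_def first_category_def
proof (safe)
  fix \<A> :: "'a set set"
  assume "countable \<A>" and \<A>: "\<forall>A\<in>\<A>. nowhere_dense A" and S: "S = \<Union>\<A>"
  let ?\<G> = "closure ` \<A> \<union> \<F>"
  have "euclidean interior_of \<Union>?\<G> = {}"
  proof (rule Baire_category_alt)
    show "completely_metrizable_space (euclidean :: 'a topology) \<or>
        locally_compact_space (euclidean :: 'a topology) \<and> regular_space (euclidean :: 'a topology)"
      using completely_metrizable_space_euclidean by blast
    show "countable ?\<G>" using \<open>countable \<A>\<close> \<open>countable \<F>\<close> by auto
    show "closedin euclidean T \<and> euclidean interior_of T = {}" if "T \<in> ?\<G>" for T
      using that \<A> \<F> by (auto simp: nowhere_dense_def)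
  qed
  moreover have "\<Union>?\<G> = UNIV"
  proof -
    have "S \<subseteq> \<Union>(closure ` \<A>)" unfolding S using closure_subset by blast
    with cover show ?thesis by auto
  qed
  ultimately show False by simp
qed


section \<open>Functions whose partial sums are bounded on a set of positive measure\<close>

lemma (in finite_measure) Bonferroni_lower_bound:
  fixes E :: "nat \<Rightarrow> 'a set"
  assumes E: "\<And>j. E j \<in> sets M"
  shows "(\<Sum>j<k. measure M (E j)) - (\<Sum>j<k. \<Sum>i<j. measure M (E i \<inter> E j)) \<le> measure M (\<Union>j<k. E j)"
proof (induction k)
  case (Suc k)
  let ?U = "\<Union>j<k. E j"
  have U: "?U \<in> sets M" using E by auto
  have "measure M (?U \<inter> E k) = measure M (\<Union>i<k. E i \<inter> E k)" by (simp only: UN_extend_simps)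
  also have "\<dots> \<le> (\<Sum>i<k. measure M (E i \<inter> E k))"
    using E by (intro finite_measure_subadditive_finite) auto
  finally have "measure M (?U \<inter> E k) \<le> (\<Sum>i<k. measure M (E i \<inter> E k))" .
  moreover have "measure M (?U \<union> E k) + measure M (?U \<inter> E k) = measure M ?U + measure M (E k)"
    using measure_Un3[of ?U M "E k"] U E by (simp add: fmeasurable_eq_sets)
  moreover have "(\<Union>j<Suc k. E j) = ?U \<union> E k" by (auto simp: lessThan_Suc)
  ultimately show ?case using Suc by simp
qed simp

text \<open>Otherwise the at most \<open>k\<^sup>2\<close> pairwise intersections would have total measure at most 1, and the lower
  bound of Bonferroni would give a union of measure greater than that of the space.\<close>

lemma (in finite_measure) exists_overlapping_pair:
  fixes E :: "nat \<Rightarrow> 'a set"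
  assumes E: "\<And>j. E j \<in> sets M" and large: "\<And>j. j < k \<Longrightarrow> \<epsilon> \<le> measure M (E j)"
    and k: "measure M (space M) + 1 < real k * \<epsilon>"
  shows "\<exists>i j. i < j \<and> j < k \<and> 1 / (real k)\<^sup>2 \<le> measure M (E i \<inter> E j)"
proof (rule ccontr)
  assume "\<not> ?thesis"
  then have small: "measure M (E i \<inter> E j) \<le> 1 / (real k)\<^sup>2" if "i < j" "j < k" for i j
    using that by (meson linear)
  have "k > 0" using k measure_nonneg[of M "space M"] by (cases k) auto
  have "(\<Sum>j<k. \<Sum>i<j. measure M (E i \<inter> E j)) \<le> (\<Sum>j<k. \<Sum>i<j. 1 / (real k)\<^sup>2)"
    using small by (intro sum_mono) auto
  also have "\<dots> \<le> (\<Sum>j<k. \<Sum>i<k. 1 / (real k)\<^sup>2)"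
    by (intro sum_mono sum_mono2) auto
  also have "\<dots> = 1" using \<open>k > 0\<close> by (simp add: power2_eq_square)
  finally have "(\<Sum>j<k. \<Sum>i<j. measure M (E i \<inter> E j)) \<le> 1" .
  moreover have "real k * \<epsilon> \<le> (\<Sum>j<k. measure M (E j))"
    using sum_mono[of "{..<k}" "\<lambda>_. \<epsilon>" "\<lambda>j. measure M (E j)"] large by simp
  moreover have "measure M (\<Union>j<k. E j) \<le> measure M (space M)" by (rule bounded_measure)
  ultimately show False using Bonferroni_lower_bound[where E = E and k = k, OF E] k by linarith
qed

definition often_bounded :: "real \<Rightarrow> real \<Rightarrow> torus_L1 set" where
  "often_bounded M \<epsilon> = {f. measure torus_measure (bounded_partial_sums_set M f) \<ge> \<epsilon>}"

text \<open>The obstacle is that the supremum over all \<open>N\<close> is not continuous in \<open>f\<close>. The set where it is at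
  most \<open>M\<close> is however the decreasing intersection of the sets \<open>B k\<close> below, which involve only \<open>N \<le> k\<close>
  and leave a margin, so that each of them contains the corresponding set of every function
  close enough to the limit.\<close>

lemma closed_often_bounded: "closed (often_bounded M \<epsilon>)"
  unfolding closed_sequential_limits
proof (intro allI impI, elim conjE)
  fix u :: "nat \<Rightarrow> torus_L1" and l
  assume u: "\<forall>j. u j \<in> often_bounded M \<epsilon>" and lim: "u \<longlonglongrightarrow> l"
  define B where "B k = {x \<in> space torus_measure.
      \<forall>N\<le>k. cmod (fourier_partial_sum N l x) \<le> M + inverse (real (Suc k))}" for k :: nat
  have B: "B k \<in> sets torus_measure" for k unfolding B_def by measurable
  have "decseq B"
  proof (rule decseq_SucI, rule subsetI)
    fix k x assume x: "x \<in> B (Suc k)"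
    have inv: "inverse (real (Suc (Suc k))) \<le> inverse (real (Suc k))"
      by (intro le_imp_inverse_le) auto
    have "cmod (fourier_partial_sum N l x) \<le> M + inverse (real (Suc k))" if "N \<le> k" for N
    proof -
      have "cmod (fourier_partial_sum N l x) \<le> M + inverse (real (Suc (Suc k)))"
        using x that unfolding B_def by simp
      with inv show ?thesis by linarith
    qed
    then show "x \<in> B k" unfolding B_def by simp
  qed
  then have "(\<lambda>k. measure torus_measure (B k)) \<longlonglongrightarrow> measure torus_measure (\<Inter>k. B k)"
    using B by (intro torus.finite_Lim_measure_decseq) auto
  also have "(\<Inter>k. B k) = bounded_partial_sums_set M l"
  proof
    show "bounded_partial_sums_set M l \<subseteq> (\<Inter>k. B k)"
    proof
      fix x assume x: "x \<in> bounded_partial_sums_set M l"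
      have "cmod (fourier_partial_sum N l x) \<le> M + inverse (real (Suc k))" for N k
      proof -
        have "cmod (fourier_partial_sum N l x) \<le> M"
          using x by (simp add: bounded_partial_sums_set_def)
        moreover have "inverse (real (Suc k)) > 0" by simp
        ultimately show ?thesis by linarith
      qed
      then show "x \<in> (\<Inter>k. B k)" by (simp add: B_def)
    qed
    show "(\<Inter>k. B k) \<subseteq> bounded_partial_sums_set M l"
      unfolding bounded_partial_sums_set_def
    proof (intro subsetI CollectI allI, rule field_le_epsilon)
      fix x N and e :: real assume x: "x \<in> (\<Inter>k. B k)" and "e > 0"
      then obtain k where k: "inverse (real (Suc k)) < e" using reals_Archimedean by blast
      have "x \<in> B (max k N)" using x by blast
      then have "cmod (fourier_partial_sum N l x) \<le> M + inverse (real (Suc (max k N)))"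
        unfolding B_def by simp
      also have "inverse (real (Suc (max k N))) \<le> inverse (real (Suc k))"
        by (intro le_imp_inverse_le) auto
      finally show "cmod (fourier_partial_sum N l x) \<le> M + e" using k by simp
    qed
  qed
  finally have "(\<lambda>k. measure torus_measure (B k)) \<longlonglongrightarrow> measure torus_measure (bounded_partial_sums_set M l)" .
  moreover have "\<epsilon> \<le> measure torus_measure (B k)" for k
  proof -
    \<comment> \<open>With this distance, no partial sum up to index \<open>k\<close> moves by more than the margin in \<open>B k\<close>.\<close>
    define \<eta> where "\<eta> = inverse (real (Suc k)) / (2 * real k + 1)"
    have "\<eta> > 0" by (simp add: \<eta>_def add_nonneg_pos)
    then obtain j where j: "norm (u j - l) < \<eta>"
      using LIMSEQ_D[OF lim] by blast
    have "bounded_partial_sums_set M (u j) \<subseteq> B k"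
    proof
      fix x assume x: "x \<in> bounded_partial_sums_set M (u j)"
      have "cmod (fourier_partial_sum N l x) \<le> M + inverse (real (Suc k))" if "N \<le> k" for N
      proof -
        have "cmod (fourier_partial_sum N (l - u j) x) \<le> (2 * real N + 1) * norm (l - u j)"
          by (rule norm_fourier_partial_sum_le)
        also have "\<dots> \<le> (2 * real k + 1) * \<eta>"
          using that j by (intro mult_mono) (auto simp: norm_minus_commute)
        also have "\<dots> = inverse (real (Suc k))" by (simp add: \<eta>_def add_nonneg_pos less_imp_neq[symmetric])
        finally have 1: "cmod (fourier_partial_sum N (l - u j) x) \<le> inverse (real (Suc k))" .
        have "fourier_partial_sum N l x = fourier_partial_sum N (u j) x + fourier_partial_sum N (l - u j) x"
          by (simp add: linear_diff[OF linear_fourier_partial_sum])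
        then have "cmod (fourier_partial_sum N l x)
            \<le> cmod (fourier_partial_sum N (u j) x) + cmod (fourier_partial_sum N (l - u j) x)"
          using norm_triangle_ineq by simp
        also have "\<dots> \<le> M + inverse (real (Suc k))"
          using 1 x by (intro add_mono) (auto simp: bounded_partial_sums_set_def)
        finally show ?thesis .
      qed
      then show "x \<in> B k" by (simp add: B_def)
    qed
    then have "measure torus_measure (bounded_partial_sums_set M (u j)) \<le> measure torus_measure (B k)"
      by (intro torus.finite_measure_mono B)
    then show ?thesis using u unfolding often_bounded_def by (auto intro: order_trans)
  qed
  ultimately show "l \<in> often_bounded M \<epsilon>"
    unfolding often_bounded_def by (auto intro: LIMSEQ_le_const)
qed

text \<open>Here the overlap argument meets the construction of Kolmogorov: a ball in \<open>often_bounded M \<epsilon>\<close> would bound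
  from below, for all \<open>g\<close> of norm at most 1, the measure of the set where the partial sums of \<open>g\<close> are
  bounded by \<open>2 M / s\<close>.\<close>

lemma interior_often_bounded:
  assumes \<epsilon>: "\<epsilon> > 0"
  shows "interior (often_bounded M \<epsilon>) = {}"
proof (rule ccontr)
  assume "interior (often_bounded M \<epsilon>) \<noteq> {}"
  then obtain f r where r: "r > 0" and ball: "ball f r \<subseteq> often_bounded M \<epsilon>"
    by (metis ex_in_conv mem_interior)
  obtain k :: nat where "2 / \<epsilon> < real k" using reals_Archimedean2 by blast
  then have k: "2 < real k * \<epsilon>" using \<epsilon> by (simp add: pos_divide_less_eq)
  then have "k > 0" by (cases k) auto
  \<comment> \<open>The step for which all \<open>f + j s g\<close> with \<open>j < k\<close> stay in the ball.\<close>
  define s where "s = r / real k"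
  have s: "s > 0" using r \<open>k > 0\<close> by (simp add: s_def)
  obtain g where g: "norm g \<le> 1"
      "measure torus_measure (bounded_partial_sums_set (2 * M / s) g) < 1 / (real k)\<^sup>2"
    using exists_small_bounded_partial_sums_set[of "1 / (real k)\<^sup>2" "2 * M / s"] \<open>k > 0\<close> by auto
  define E where "E j = bounded_partial_sums_set M (f + (real j * s) *\<^sub>R g)" for j :: nat
  have "\<epsilon> \<le> measure torus_measure (E j)" if "j < k" for j
  proof -
    have "norm ((real j * s) *\<^sub>R g) \<le> (real j * s) * 1"
      using mult_left_mono[OF g(1), of "real j * s"] s by simp
    also have "\<dots> < real k * s" using that s by simp
    also have "\<dots> = r" using \<open>k > 0\<close> by (simp add: s_def)
    finally have "f + (real j * s) *\<^sub>R g \<in> ball f r" by (simp add: dist_norm)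
    then show ?thesis using ball by (auto simp: E_def often_bounded_def)
  qed
  then obtain i j where ij: "i < j" "1 / (real k)\<^sup>2 \<le> measure torus_measure (E i \<inter> E j)"
    using torus.exists_overlapping_pair[of E k \<epsilon>] k by (auto simp: E_def measure_torus_UNIV)
  have "E i \<inter> E j \<subseteq> bounded_partial_sums_set (2 * M / s) g"
  proof
    fix x assume x: "x \<in> E i \<inter> E j"
    have "cmod (fourier_partial_sum N g x) \<le> 2 * M / s" for N
    proof -
      let ?S = "\<lambda>h. fourier_partial_sum N h x"
      have "?S (f + (real j * s) *\<^sub>R g) - ?S (f + (real i * s) *\<^sub>R g) = ((real j - real i) * s) *\<^sub>R ?S g"
        by (simp add: linear_add[OF linear_fourier_partial_sum]
            linear_scale[OF linear_fourier_partial_sum] algebra_simps)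
      then have "(real j - real i) * s * cmod (?S g)
          = cmod (?S (f + (real j * s) *\<^sub>R g) - ?S (f + (real i * s) *\<^sub>R g))"
        using ij(1) s by simp
      also have "\<dots> \<le> M + M"
        using x unfolding E_def bounded_partial_sums_set_def
        by (intro order_trans[OF norm_triangle_ineq4] add_mono) auto
      finally have "(real j - real i) * (s * cmod (?S g)) \<le> 2 * M" by (simp add: mult_ac)
      moreover have "1 * (s * cmod (?S g)) \<le> (real j - real i) * (s * cmod (?S g))"
        using ij(1) s by (intro mult_right_mono) auto
      ultimately have "s * cmod (?S g) \<le> 2 * M" by linarith
      then show ?thesis using s by (simp add: pos_le_divide_eq mult_ac)
    qed
    then show "x \<in> bounded_partial_sums_set (2 * M / s) g"
      by (simp add: bounded_partial_sums_set_def)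
  qed
  then have "measure torus_measure (E i \<inter> E j)
      \<le> measure torus_measure (bounded_partial_sums_set (2 * M / s) g)"
    by (intro torus.finite_measure_mono sets_bounded_partial_sums_set)
  then show False using ij g(2) by linarith
qed


section \<open>Almost everywhere divergence\<close>

lemma SUP_partial_sums_eq_infinity_iff:
  "(SUP N. ereal (cmod (fourier_partial_sum N f x))) = \<infinity>
     \<longleftrightarrow> (\<forall>m :: nat. x \<notin> bounded_partial_sums_set (real m) f)" (is "?L \<longleftrightarrow> ?R")
proof
  assume ?L
  show ?R
  proof (intro allI notI)
    fix m :: nat assume "x \<in> bounded_partial_sums_set (real m) f"
    then have "(SUP N. ereal (cmod (fourier_partial_sum N f x))) \<le> ereal (real m)"
      by (intro SUP_least) (simp add: bounded_partial_sums_set_def)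
    with \<open>?L\<close> show False by simp
  qed
next
  assume ?R
  then show ?L
    by (intro SUP_PInfty) (force simp: bounded_partial_sums_set_def not_le intro: less_imp_le)
qed

lemma complement_divergence_set_covered:
  assumes "measure torus_measure {x. (SUP N. ereal (cmod (fourier_partial_sum N f x))) = \<infinity>} \<noteq> 1"
  shows "\<exists>m k :: nat. f \<in> often_bounded (real m) (inverse (real (Suc k)))"
proof (rule ccontr)
  assume *: "\<not> ?thesis"
  let ?B = "\<lambda>m :: nat. bounded_partial_sums_set (real m) f"
  have "measure torus_measure (?B m) = 0" for m
  proof (rule ccontr)
    assume "measure torus_measure (?B m) \<noteq> 0"
    then have "measure torus_measure (?B m) > 0" by (simp add: zero_less_measure_iff)
    then obtain k where "inverse (real (Suc k)) < measure torus_measure (?B m)"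
      using reals_Archimedean by blast
    then have "f \<in> often_bounded (real m) (inverse (real (Suc k)))"
      unfolding often_bounded_def by simp
    then show False using * by blast
  qed
  then have "?B m \<in> null_sets torus_measure" for m
    by (simp add: null_sets_def torus.emeasure_eq_measure)
  then have null: "(\<Union>m. ?B m) \<in> null_sets torus_measure" by auto
  have "{x. (SUP N. ereal (cmod (fourier_partial_sum N f x))) = \<infinity>} = space torus_measure - (\<Union>m. ?B m)"
    by (auto simp: SUP_partial_sums_eq_infinity_iff)
  then have "measure torus_measure {x. (SUP N. ereal (cmod (fourier_partial_sum N f x))) = \<infinity>} = 1"
    using null torus.finite_measure_compl[of "\<Union>m. ?B m"]
    by (simp add: measure_torus_UNIV measure_eq_0_null_sets null_setsD2)
  with assms show False by simp
qed

lemma AE_not_convergent_if_SUP_infinite: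
  assumes "measure torus_measure {x. (SUP N. ereal (cmod (fourier_partial_sum N f x))) = \<infinity>} = 1"
  shows "AE x in torus_measure. \<not> convergent (\<lambda>N. fourier_partial_sum N f x)"
proof -
  let ?D = "{x \<in> space torus_measure. (SUP N. ereal (cmod (fourier_partial_sum N f x))) = \<infinity>}"
  have D: "?D \<in> sets torus_measure" by measurable
  have "measure torus_measure (space torus_measure - ?D) = 0"
    using torus.finite_measure_compl[OF D] assms by (simp add: measure_torus_UNIV)
  then have "space torus_measure - ?D \<in> null_sets torus_measure"
    using sets.compl_sets[OF D] by (simp add: null_sets_def torus.emeasure_eq_measure)
  then have "AE x in torus_measure. x \<notin> space torus_measure - ?D" by (rule AE_not_in)
  then show ?thesis
  proof eventually_elim
    case (elim x)
    then have inf: "(SUP N. ereal (cmod (fourier_partial_sum N f x))) = \<infinity>" by simp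
    show ?case
    proof
      assume "convergent (\<lambda>N. fourier_partial_sum N f x)"
      then have "Bseq (\<lambda>N. fourier_partial_sum N f x)" by (rule convergent_imp_Bseq)
      then obtain K where K: "\<And>N. cmod (fourier_partial_sum N f x) \<le> K" by (auto simp: Bseq_def)
      obtain m :: nat where "K \<le> real m" using real_arch_simple by blast
      then have "x \<in> bounded_partial_sums_set (real m) f"
        using K order_trans unfolding bounded_partial_sums_set_def by blast
      then show False using inf SUP_partial_sums_eq_infinity_iff by blast
    qed
  qed
qed

theorem theorem1p1:
  shows "second_category {f :: torus_L1.
           measure torus_measure {x. (SUP N. ereal (cmod (fourier_partial_sum N f x))) = \<infinity>} = 1}
       \<and> second_category {f :: torus_L1.
           AE x in torus_measure. \<not> convergent (\<lambda>N. fourier_partial_sum N f x)}"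
proof -
  define \<F> where "\<F> = range (\<lambda>(m :: nat, k :: nat). often_bounded (real m) (inverse (real (Suc k))))"
  have "countable \<F>" by (simp add: \<F>_def)
  moreover have "closed F \<and> interior F = {}" if "F \<in> \<F>" for F
    using that by (auto simp: \<F>_def closed_often_bounded interior_often_bounded)
  moreover have cover: "f \<in> \<Union>\<F>"
    if "measure torus_measure {x. (SUP N. ereal (cmod (fourier_partial_sum N f x))) = \<infinity>} \<noteq> 1" for f
    using complement_divergence_set_covered[OF that] by (force simp: \<F>_def)
  ultimately show ?thesis
    using AE_not_convergent_if_SUP_infinite
    by (intro conjI; intro second_category_if_complement_covered[of \<F>]) blast+
qed

end
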